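(* Let $K$ be a commutative ring with identity. For every $n\ge 1$, $\overline S(\widetilde M_n,K)=\mathrm{Der}_*(L_K(X_n))$.
   Context: $V_n$ is the free $K$-module on $X_n=\{x_1,\dots,x_n\}$, and $L_K(X_n)=\bigoplus_{p\ge1}L_K^p(X_n)$ is the free Lie algebra graded by bracket length, regarded as a Lie subalgebra of the tensor algebra, with $L^q_K(X_n)\subseteq V_n^{\otimes q}$. $\Sigma_q$ acts on $V_n^{\otimes q}$ by $\sigma(y_1\otimes\cdots\otimes y_q)=y_{\sigma^{-1}(1)}\otimes\cdots\otimes y_{\sigma^{-1}(q)}$. $\mathrm{Schur}(q,n,K)$ is the algebra of $K$-linear endomorphisms of $V_n^{\otimes q}$ commuting with $\Sigma_q$; its elements map $L_K^q(X_n)$ into itself. $\mathrm{Der}_p(L_K(X_n))$ is the set of derivations $\theta$ of $L_K(X_n)$ with $\theta(x_i)\in L_K^p(X_n)$ for all $i$; $\mathrm{Der}_*(L_K(X_n))=\bigoplus_{p\ge2}\mathrm{Der}_p(L_K(X_n))$ with bracket $[D,D']=DD'-D'D$. For $f\in\mathrm{Schur}(q,n,K)$ and $\theta\in\mathrm{Der}_q(L_K(X_n))$, $\Phi_f(\theta)$ is the unique derivation with $\Phi_f(\theta)(x_i)=f(\theta(x_i))$ for all $i$. $\widetilde M_n$ is the set of derivations $\widetilde\chi_{i,j}$ ($i\neq j$), where $\widetilde\chi_{i,j}(x_i)=[x_i,x_j]$ and $\widetilde\chi_{i,j}(x_k)=0$ for $k\ne i$, together with $\widetilde\theta_{i,[x_s,x_t]}$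 ($s<t$, $i\notin\{s,t\}$), where $\widetilde\theta_{i,[x_s,x_t]}(x_i)=[x_s,x_t]$ and $\widetilde\theta_{i,[x_s,x_t]}(x_k)=0$ for $k\neq i$. $\overline S(\widetilde M_n,K)$ is the smallest Lie subalgebra $S$ of $\mathrm{Der}_*(L_K(X_n))$ that contains $\widetilde M_n$ and is invariant under the Schur algebras, i.e. $\Phi_f(S\cap\mathrm{Der}_q(L_K(X_n)))\subseteq S$ for all $q\ge2$ and all $f\in\mathrm{Schur}(q,n,K)$. *)

theory Defs
  imports "HOL-Library.Poly_Mapping" "HOL-Combinatorics.Permutations"
begin

text \<open>
  The tensor algebra of the free module on \<open>x\<^sub>1, x\<^sub>2, \<dots>\<close> is the monoid algebra of the free monoid of
  words in the letters \<open>1, 2, \<dots>\<close>; the instance below makes the library's product on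
  \<open>nat list \<Rightarrow>\<^sub>0 'k\<close> the concatenation (tensor) product.  The word \<open>[i\<^sub>1, \<dots>, i\<^sub>q]\<close> stands for
  \<open>x\<^bsub>i\<^sub>1\<^esub> \<otimes> \<dots> \<otimes> x\<^bsub>i\<^sub>q\<^esub>\<close>.
\<close>

instantiation list :: (type) monoid_add
begin

definition zero_list :: "'a list" where "zero_list = []"

definition plus_list :: "'a list \<Rightarrow> 'a list \<Rightarrow> 'a list" where "plus_list u v = u @ v"

instance by standard (simp_all add: zero_list_def plus_list_def)

end

text \<open>
  Coefficients have sort \<open>{comm_ring, comm_monoid_mult}\<close>: commutative rings with identity, where,
  unlike in \<open>comm_ring_1\<close>, the zero ring is allowed.
\<close>

type_synonym 'k tensor = "nat list \<Rightarrow>\<^sub>0 'k"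

definition gen :: "nat \<Rightarrow> 'k::{comm_ring, comm_monoid_mult} tensor" where
  "gen i = Poly_Mapping.single [i] 1"

definition smult :: "'k::{comm_ring, comm_monoid_mult} \<Rightarrow> 'k tensor \<Rightarrow> 'k tensor" where
  "smult c a = Poly_Mapping.map (\<lambda>x. c * x) a"

definition bracket ::
    "'k::{comm_ring, comm_monoid_mult} tensor \<Rightarrow> 'k tensor \<Rightarrow> 'k tensor" where
  "bracket a b = a * b - b * a"

definition tensor_power :: "nat \<Rightarrow> nat \<Rightarrow> 'k::{comm_ring, comm_monoid_mult} tensor set" where
  "tensor_power n q = {a. \<forall>w \<in> Poly_Mapping.keys a. length w = q \<and> set w \<subseteq> {1..n}}"

text \<open>
  The free Lie algebra on \<open>x\<^sub>1, \<dots>, x\<^sub>n\<close>, regarded as the Lie subalgebra of the tensor algebra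
  generated by the \<open>x\<^sub>i\<close>, and its homogeneous parts, spanned by the \<open>p\<close>-fold brackets of generators.
\<close>

inductive_set free_lie :: "nat \<Rightarrow> 'k::{comm_ring, comm_monoid_mult} tensor set" for n :: nat where
  gen: "i \<in> {1..n} \<Longrightarrow> gen i \<in> free_lie n"
| zero: "0 \<in> free_lie n"
| add: "a \<in> free_lie n \<Longrightarrow> b \<in> free_lie n \<Longrightarrow> a + b \<in> free_lie n"
| smult: "a \<in> free_lie n \<Longrightarrow> smult c a \<in> free_lie n"
| bracket: "a \<in> free_lie n \<Longrightarrow> b \<in> free_lie n \<Longrightarrow> bracket a b \<in> free_lie n"

inductive in_lie_part :: "nat \<Rightarrow> nat \<Rightarrow> 'k::{comm_ring, comm_monoid_mult} tensor \<Rightarrow> bool"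
  for n :: nat where
  gen: "i \<in> {1..n} \<Longrightarrow> in_lie_part n 1 (gen i)"
| zero: "in_lie_part n p 0"
| add: "in_lie_part n p a \<Longrightarrow> in_lie_part n p b \<Longrightarrow> in_lie_part n p (a + b)"
| smult: "in_lie_part n p a \<Longrightarrow> in_lie_part n p (smult c a)"
| bracket: "in_lie_part n p a \<Longrightarrow> in_lie_part n q b \<Longrightarrow> in_lie_part n (p + q) (bracket a b)"

definition lie_part :: "nat \<Rightarrow> nat \<Rightarrow> 'k::{comm_ring, comm_monoid_mult} tensor set" where
  "lie_part n p = {a. in_lie_part n p a}"

text \<open>
  \<open>K\<close>-linear endomorphisms of a submodule \<open>U\<close>.  To make equality of functions equality of
  endomorphisms, they are extended by \<open>0\<close> outside \<open>U\<close>.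
\<close>

definition linear_endos ::
    "'k::{comm_ring, comm_monoid_mult} tensor set \<Rightarrow> ('k tensor \<Rightarrow> 'k tensor) set" where
  "linear_endos U = {f.
     (\<forall>a\<in>U. f a \<in> U) \<and>
     (\<forall>a\<in>U. \<forall>b\<in>U. f (a + b) = f a + f b) \<and>
     (\<forall>c. \<forall>a\<in>U. f (smult c a) = smult c (f a)) \<and>
     (\<forall>a. a \<notin> U \<longrightarrow> f a = 0)}"

text \<open>
  Since \<open>permute_list f [y\<^sub>0, \<dots>] = [y\<^bsub>f 0\<^esub>, \<dots>]\<close>, the inverse below gives the left action
  \<open>\<sigma> (y\<^sub>1 \<otimes> \<dots> \<otimes> y\<^sub>q) = y\<^bsub>inv \<sigma> 1\<^esub> \<otimes> \<dots> \<otimes> y\<^bsub>inv \<sigma> q\<^esub>\<close>; positions are counted from \<open>0\<close>, so the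
  symmetric group consists of the \<open>\<sigma>\<close> with \<open>\<sigma> permutes {..<q}\<close>.
\<close>

definition perm_action ::
    "(nat \<Rightarrow> nat) \<Rightarrow> 'k::{comm_ring, comm_monoid_mult} tensor \<Rightarrow> 'k tensor" where
  "perm_action \<sigma> a = (\<Sum>w \<in> Poly_Mapping.keys a.
     Poly_Mapping.single (permute_list (inv \<sigma>) w) (Poly_Mapping.lookup a w))"

definition Schur ::
    "nat \<Rightarrow> nat \<Rightarrow> ('k::{comm_ring, comm_monoid_mult} tensor \<Rightarrow> 'k tensor) set" where
  "Schur q n = {f \<in> linear_endos (tensor_power n q).
     \<forall>\<sigma>. \<sigma> permutes {..<q} \<longrightarrow>
       (\<forall>a \<in> tensor_power n q. f (perm_action \<sigma> a) = perm_action \<sigma> (f a))}"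

definition Der :: "nat \<Rightarrow> ('k::{comm_ring, comm_monoid_mult} tensor \<Rightarrow> 'k tensor) set" where
  "Der n = {D \<in> linear_endos (free_lie n).
     \<forall>a \<in> free_lie n. \<forall>b \<in> free_lie n. D (bracket a b) = bracket (D a) b + bracket a (D b)}"

definition Der_deg ::
    "nat \<Rightarrow> nat \<Rightarrow> ('k::{comm_ring, comm_monoid_mult} tensor \<Rightarrow> 'k tensor) set" where
  "Der_deg n p = {D \<in> Der n. \<forall>i \<in> {1..n}. D (gen i) \<in> lie_part n p}"

definition Der_star :: "nat \<Rightarrow> ('k::{comm_ring, comm_monoid_mult} tensor \<Rightarrow> 'k tensor) set" where
  "Der_star n = {(\<lambda>a. \<Sum>p\<in>P. D p a) | P D. finite P \<and> P \<subseteq> {2..} \<and> (\<forall>p\<in>P. D p \<in> Der_deg n p)}"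

definition der_bracket ::
    "('k::{comm_ring, comm_monoid_mult} tensor \<Rightarrow> 'k tensor) \<Rightarrow> ('k tensor \<Rightarrow> 'k tensor) \<Rightarrow>
     'k tensor \<Rightarrow> 'k tensor" where
  "der_bracket D D' = (\<lambda>a. D (D' a) - D' (D a))"

text \<open>
  The derivation with prescribed values \<open>v i\<close> on the \<open>x\<^sub>i\<close>.  It exists and is unique by freeness
  whenever the \<open>v i\<close> lie in \<open>free_lie n\<close>, which is the case in all uses below.
\<close>

definition der_of ::
    "nat \<Rightarrow> (nat \<Rightarrow> 'k::{comm_ring, comm_monoid_mult} tensor) \<Rightarrow> 'k tensor \<Rightarrow> 'k tensor" where
  "der_of n v = (THE D. D \<in> Der n \<and> (\<forall>i \<in> {1..n}. D (gen i) = v i))"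

definition Phi ::
    "nat \<Rightarrow> ('k::{comm_ring, comm_monoid_mult} tensor \<Rightarrow> 'k tensor) \<Rightarrow>
     ('k tensor \<Rightarrow> 'k tensor) \<Rightarrow> 'k tensor \<Rightarrow> 'k tensor" where
  "Phi n f \<theta> = der_of n (\<lambda>i. f (\<theta> (gen i)))"

definition chi_tilde ::
    "nat \<Rightarrow> nat \<Rightarrow> nat \<Rightarrow> 'k::{comm_ring, comm_monoid_mult} tensor \<Rightarrow> 'k tensor" where
  "chi_tilde n i j = der_of n (\<lambda>k. if k = i then bracket (gen i) (gen j) else 0)"

definition theta_tilde ::
    "nat \<Rightarrow> nat \<Rightarrow> nat \<Rightarrow> nat \<Rightarrow> 'k::{comm_ring, comm_monoid_mult} tensor \<Rightarrow> 'k tensor" where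
  "theta_tilde n i s t = der_of n (\<lambda>k. if k = i then bracket (gen s) (gen t) else 0)"

definition M_tilde :: "nat \<Rightarrow> ('k::{comm_ring, comm_monoid_mult} tensor \<Rightarrow> 'k tensor) set" where
  "M_tilde n =
     {chi_tilde n i j | i j. i \<in> {1..n} \<and> j \<in> {1..n} \<and> i \<noteq> j} \<union>
     {theta_tilde n i s t | i s t.
        i \<in> {1..n} \<and> s \<in> {1..n} \<and> t \<in> {1..n} \<and> s < t \<and> i \<notin> {s, t}}"

definition lie_subalgebra_Der_star ::
    "nat \<Rightarrow> ('k::{comm_ring, comm_monoid_mult} tensor \<Rightarrow> 'k tensor) set \<Rightarrow> bool" where
  "lie_subalgebra_Der_star n S \<longleftrightarrow>
     S \<subseteq> Der_star n \<and>
     (\<lambda>_. 0) \<in> S \<and>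
     (\<forall>D\<in>S. \<forall>D'\<in>S. (\<lambda>a. D a + D' a) \<in> S) \<and>
     (\<forall>c. \<forall>D\<in>S. (\<lambda>a. smult c (D a)) \<in> S) \<and>
     (\<forall>D\<in>S. \<forall>D'\<in>S. der_bracket D D' \<in> S)"

definition Schur_invariant ::
    "nat \<Rightarrow> ('k::{comm_ring, comm_monoid_mult} tensor \<Rightarrow> 'k tensor) set \<Rightarrow> bool" where
  "Schur_invariant n S \<longleftrightarrow>
     (\<forall>q\<ge>2. \<forall>f \<in> Schur q n. Phi n f ` (S \<inter> Der_deg n q) \<subseteq> S)"

text \<open>
  The smallest such subalgebra exists, since all the conditions are preserved by intersections and
  hold for \<open>Der_star n\<close>.
\<close>

definition S_bar ::
    "nat \<Rightarrow> ('k::{comm_ring, comm_monoid_mult} tensor \<Rightarrow> 'k tensor) set \<Rightarrow>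
     ('k tensor \<Rightarrow> 'k tensor) set" where
  "S_bar n M = \<Inter>{S. lie_subalgebra_Der_star n S \<and> M \<subseteq> S \<and> Schur_invariant n S}"

end

theory Submission
  imports Defs
begin

text \<open>
  Write \<open>D(i, a)\<close> for the derivation \<open>x\<^sub>i \<mapsto> a\<close> that kills the other generators.  Since \<open>L\<^sup>q\<close> is spanned by
  right-normed brackets \<open>rn w\<close>, it suffices to obtain all \<open>D(i, rn w)\<close>, by induction on the length of the
  word \<open>w\<close>; the case of length \<open>2\<close> is given by the generators.  For \<open>k \<noteq> i\<close>,
  \<open>[D(k, u), D(i, [x\<^sub>i, x\<^sub>k])] = D(i, [x\<^sub>i, u]) - D(k, D(i, [x\<^sub>i, x\<^sub>k]) u)\<close>,
  and the two summands have values of different degree in \<open>x\<^sub>i\<close>.  Projecting tensors onto a fixed degree in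
  \<open>x\<^sub>i\<close> and then exchanging \<open>x\<^sub>i\<close> with \<open>x\<^sub>j\<close> commutes with permutations of the tensor factors, so the
  Schur algebra turns this bracket into \<open>D(i, [x\<^sub>j, u'])\<close>, where \<open>u'\<close> is an arbitrary right-normed bracket.

  That \<open>Der\<^sub>*\<close> is itself invariant holds because \<open>L\<^sup>q\<close> is the image of an element of the group ring of
  \<open>\<Sigma>\<^sub>q\<close>, with which every element of the Schur algebra commutes.
\<close>

section \<open>Linear extension from words\<close>

lemma lookup_smult [simp]: "Poly_Mapping.lookup (smult c a) w = c * Poly_Mapping.lookup a w"
  by (simp add: smult_def map.rep_eq when_def)

lemma smult_simps [simp]:
  "smult c 0 = 0" "smult 0 a = 0" "smult 1 a = a"
  "smult c (smult d a) = smult (c * d) a"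
  "smult c (Poly_Mapping.single w d) = Poly_Mapping.single w (c * d)"
  by (auto intro!: poly_mapping_eqI simp: mult.assoc lookup_single when_def)

lemma smult_distrib:
  "smult c (a + b) = smult c a + smult c b"
  "smult c (a - b) = smult c a - smult c b"
  "smult (c + d) a = smult c a + smult d a"
  "smult (- c) a = - smult c a"
  by (auto intro!: poly_mapping_eqI simp: lookup_add lookup_minus algebra_simps)

lemma smult_minus: "smult c (- a) = - smult c a"
  by (rule poly_mapping_eqI) simp

lemma smult_sum: "smult c (\<Sum>x\<in>A. h x) = (\<Sum>x\<in>A. smult c (h x))"
  by (induction A rule: infinite_finite_induct) (simp_all add: smult_distrib)

lemma sum_singles: "(\<Sum>w\<in>Poly_Mapping.keys a. Poly_Mapping.single w (Poly_Mapping.lookup a w)) = a"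
proof (rule poly_mapping_eqI)
  fix v
  show "Poly_Mapping.lookup (\<Sum>w\<in>Poly_Mapping.keys a. Poly_Mapping.single w (Poly_Mapping.lookup a w)) v
      = Poly_Mapping.lookup a v"
    by (cases "v \<in> Poly_Mapping.keys a")
      (simp_all add: lookup_sum lookup_single when_def in_keys_iff)
qed

text \<open>Restricting the words to \<open>W\<close> keeps the length and alphabet conditions of
  \<open>tensor_power\<close> available during the induction.\<close>

lemma tensor_induct_on [consumes 1, case_names zero single add]:
  fixes a :: "'a::type \<Rightarrow>\<^sub>0 'k::comm_monoid_add"
  assumes "Poly_Mapping.keys a \<subseteq> W" "P 0" "\<And>w c. w \<in> W \<Longrightarrow> P (Poly_Mapping.single w c)"
    and "\<And>a b. P a \<Longrightarrow> P b \<Longrightarrow> P (a + b)"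
  shows "P a"
proof -
  have "P (\<Sum>w\<in>A. Poly_Mapping.single w (Poly_Mapping.lookup a w))" if "finite A" "A \<subseteq> W" for A
    using that by (induction A rule: finite_induct) (auto intro: assms(2-4))
  from this[OF _ assms(1)] show ?thesis by (simp add: sum_singles)
qed

lemmas tensor_induct [case_names zero single add] = tensor_induct_on[where W = UNIV, simplified]

text \<open>Bracketing of words, derivations, the symmetric group action and renaming of letters all
  take this form, so identities between them can be checked on words.\<close>

definition lin :: "(nat list \<Rightarrow> 'k::{comm_ring, comm_monoid_mult} tensor) \<Rightarrow> 'k tensor \<Rightarrow> 'k tensor" where
  "lin g a = (\<Sum>w\<in>Poly_Mapping.keys a. smult (Poly_Mapping.lookup a w) (g w))"

text \<open>Cancellation can shrink the support of a sum, so additivity is read off by summing over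
  a common finite superset of the supports.\<close>

lemma lin_superset:
  assumes "finite A" "Poly_Mapping.keys a \<subseteq> A"
  shows "lin g a = (\<Sum>w\<in>A. smult (Poly_Mapping.lookup a w) (g w))"
  unfolding lin_def using assms by (intro sum.mono_neutral_left) (auto simp: in_keys_iff)

lemma lin_zero [simp]: "lin g 0 = 0"
  by (simp add: lin_def)

lemma lin_single [simp]: "lin g (Poly_Mapping.single w c) = smult c (g w)"
  by (simp add: lin_def)

lemma lin_add: "lin g (a + b) = lin g a + lin g b"
proof -
  let ?A = "Poly_Mapping.keys a \<union> Poly_Mapping.keys b"
  have "finite ?A" "Poly_Mapping.keys (a + b) \<subseteq> ?A" by (simp_all add: keys_add)
  then show ?thesis
    by (simp add: lin_superset[of ?A] lookup_add smult_distrib sum.distrib)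
qed

lemma lin_smult: "lin g (smult c a) = smult c (lin g a)"
  by (induction a rule: tensor_induct) (simp_all add: smult_distrib lin_add)

lemma lin_minus: "lin g (- a) = - lin g a"
  using lin_smult[of g "-1" a] by (simp add: smult_distrib)

lemma lin_diff: "lin g (a - b) = lin g a - lin g b"
  using lin_add[of g a "- b"] by (simp add: lin_minus)

lemma lin_cong: "(\<And>w. w \<in> Poly_Mapping.keys a \<Longrightarrow> g w = h w) \<Longrightarrow> lin g a = lin h a"
  by (simp add: lin_def)

lemma lin_lin: "lin g (lin h a) = lin (\<lambda>w. lin g (h w)) a"
  by (induction a rule: tensor_induct) (simp_all add: lin_add lin_smult)

lemma lin_fun_add: "lin (\<lambda>w. g w + h w) a = lin g a + lin h a"
  by (simp add: lin_def smult_distrib sum.distrib)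

lemma lin_fun_minus: "lin (\<lambda>w. - g w) a = - lin g a"
  by (simp add: lin_def smult_minus sum_negf)

lemma lin_fun_zero: "lin (\<lambda>w. 0) a = 0"
  by (simp add: lin_def)

lemma smult_mult_left: "smult c a * b = smult c (a * b)"
proof (induction a rule: tensor_induct)
  case (single u d)
  show ?case
    by (induction b rule: tensor_induct)
      (simp_all add: mult_single smult_distrib algebra_simps)
qed (simp_all add: smult_distrib algebra_simps)

lemma smult_mult_right: "a * smult c b = smult c (a * b)"
proof (induction a rule: tensor_induct)
  case (single u d)
  show ?case
    by (induction b rule: tensor_induct)
      (simp_all add: mult_single smult_distrib algebra_simps)
qed (simp_all add: smult_distrib algebra_simps)

lemma single_mult [simp]:
  "Poly_Mapping.single u c * Poly_Mapping.single v d = Poly_Mapping.single (u @ v) (c * d)"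
  for c d :: "'k::{comm_ring, comm_monoid_mult}"
  by (simp add: mult_single plus_list_def)

lemma single_mult_assoc [simp]:
  "Poly_Mapping.single u c * (Poly_Mapping.single v d * a) = Poly_Mapping.single (u @ v) (c * d) * a"
  for c d :: "'k::{comm_ring, comm_monoid_mult}"
  by (simp flip: mult.assoc)

lemma single_Nil_mult [simp]:
  "Poly_Mapping.single [] 1 * a = a" "a * Poly_Mapping.single [] 1 = a"
  for a :: "'k::{comm_ring, comm_monoid_mult} tensor"
  by (induction a rule: tensor_induct) (simp_all add: algebra_simps)

lemma keys_mult_words:
  "Poly_Mapping.keys (a * b) \<subseteq> {u @ v |u v. u \<in> Poly_Mapping.keys a \<and> v \<in> Poly_Mapping.keys b}"
  for a :: "'k::{comm_ring, comm_monoid_mult} tensor"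
  using keys_mult[of a b] by (simp add: plus_list_def)

lemma keys_uminus: "Poly_Mapping.keys (- a) = Poly_Mapping.keys a"
  for a :: "'a \<Rightarrow>\<^sub>0 'k::ab_group_add"
  by (auto simp: in_keys_iff)

lemma keys_diff_subset:
  "Poly_Mapping.keys (a - b) \<subseteq> Poly_Mapping.keys a \<union> Poly_Mapping.keys b"
  for a :: "'a \<Rightarrow>\<^sub>0 'k::ab_group_add"
  using keys_add[of a "- b"] by (simp add: keys_uminus)

lemma keys_smult_subset: "Poly_Mapping.keys (smult c a) \<subseteq> Poly_Mapping.keys a"
  by (auto simp: in_keys_iff)

section \<open>The Lie bracket\<close>

lemma bracket_simps [simp]: "bracket 0 b = 0" "bracket a 0 = 0" "bracket a a = 0"
  by (simp_all add: bracket_def)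

lemma bracket_linear:
  "bracket (a + b) c = bracket a c + bracket b c"
  "bracket c (a + b) = bracket c a + bracket c b"
  "bracket (smult k a) c = smult k (bracket a c)"
  "bracket c (smult k a) = smult k (bracket c a)"
  "bracket (- a) c = - bracket a c"
  "bracket (a - b) c = bracket a c - bracket b c"
  "bracket c (a - b) = bracket c a - bracket c b"
  by (simp_all add: bracket_def algebra_simps smult_mult_left smult_mult_right smult_distrib)

lemma bracket_swap: "bracket a b = - bracket b a"
  by (simp add: bracket_def)

text \<open>The Jacobi identity as ad [a, b] = ad a ad b - ad b ad a, the form that moves the first
  letter out of a right-normed left factor.\<close>

lemma bracket_jacobi: "bracket (bracket a b) c = bracket a (bracket b c) - bracket b (bracket a c)"
  by (simp add: bracket_def algebra_simps)

section \<open>Homogeneous Lie elements and tensor powers\<close>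

lemma gen_mem_lie_part: "i \<in> {1..n} \<Longrightarrow> gen i \<in> lie_part n 1"
  unfolding lie_part_def mem_Collect_eq by (rule in_lie_part.gen)

lemma lie_part_closed:
  shows lie_part_zero: "0 \<in> lie_part n p"
    and lie_part_add: "a \<in> lie_part n p \<Longrightarrow> b \<in> lie_part n p \<Longrightarrow> a + b \<in> lie_part n p"
    and lie_part_smult: "a \<in> lie_part n p \<Longrightarrow> smult c a \<in> lie_part n p"
    and lie_part_bracket: "a \<in> lie_part n p \<Longrightarrow> b \<in> lie_part n q \<Longrightarrow> bracket a b \<in> lie_part n (p + q)"
  by (auto simp: lie_part_def intro: in_lie_part.intros)

lemma lie_part_diff: "a \<in> lie_part n p \<Longrightarrow> b \<in> lie_part n p \<Longrightarrow> a - b \<in> lie_part n p"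
  using lie_part_add[of a n p "smult (-1) b"] lie_part_smult[of b n p "-1"]
  by (simp add: smult_distrib)

lemma free_lie_diff: "a \<in> free_lie n \<Longrightarrow> b \<in> free_lie n \<Longrightarrow> a - b \<in> free_lie n"
  using free_lie.add[of a n "smult (-1) b"] free_lie.smult[of b n "-1"]
  by (simp add: smult_distrib)

lemma lie_part_subset_free_lie: "lie_part n p \<subseteq> (free_lie n :: 'k::{comm_ring, comm_monoid_mult} tensor set)"
proof
  fix a :: "'k tensor" assume "a \<in> lie_part n p"
  then have "in_lie_part n p a" by (simp add: lie_part_def)
  then show "a \<in> free_lie n" by induction (auto intro: free_lie.intros)
qed

lemma tensor_power_zero: "0 \<in> tensor_power n q"
  by (simp add: tensor_power_def)

lemma tensor_power_single:
  "length w = q \<Longrightarrow> set w \<subseteq> {1..n} \<Longrightarrow> Poly_Mapping.single w c \<in> tensor_power n q"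
  by (simp add: tensor_power_def)

lemma tensor_power_add: "a \<in> tensor_power n q \<Longrightarrow> b \<in> tensor_power n q \<Longrightarrow> a + b \<in> tensor_power n q"
  using keys_add[of a b] by (fastforce simp: tensor_power_def)

lemma tensor_power_smult: "a \<in> tensor_power n q \<Longrightarrow> smult c a \<in> tensor_power n q"
  using keys_smult_subset[of c a] by (fastforce simp: tensor_power_def)

lemma tensor_power_minus: "a \<in> tensor_power n q \<Longrightarrow> - a \<in> tensor_power n q"
  by (simp add: tensor_power_def keys_uminus)

lemma tensor_power_diff: "a \<in> tensor_power n q \<Longrightarrow> b \<in> tensor_power n q \<Longrightarrow> a - b \<in> tensor_power n q"
  using keys_diff_subset[of a b] by (fastforce simp: tensor_power_def)

lemma tensor_power_mult:
  "a \<in> tensor_power n p \<Longrightarrow> b \<in> tensor_power n q \<Longrightarrow> a * b \<in> tensor_power n (p + q)"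
  using keys_mult_words[of a b] by (fastforce simp: tensor_power_def)

lemma lin_mem_tensor_power:
  assumes "a \<in> tensor_power n p"
    and "\<And>w. length w = p \<Longrightarrow> set w \<subseteq> {1..n} \<Longrightarrow> g w \<in> tensor_power n q"
  shows "lin g a \<in> tensor_power n q"
proof -
  have "Poly_Mapping.keys a \<subseteq> {w. length w = p \<and> set w \<subseteq> {1..n}}"
    using assms(1) by (auto simp: tensor_power_def)
  then show ?thesis
    by (induction rule: tensor_induct_on)
      (simp_all add: tensor_power_zero lin_add tensor_power_add assms(2) tensor_power_smult)
qed

lemma lie_part_subset_tensor_power: "lie_part n p \<subseteq> (tensor_power n p :: 'k::{comm_ring, comm_monoid_mult} tensor set)"
proof
  fix a :: "'k tensor" assume "a \<in> lie_part n p"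
  then have "in_lie_part n p a" by (simp add: lie_part_def)
  then show "a \<in> tensor_power n p"
  proof induction
    case (gen i)
    then show ?case by (simp add: gen_def tensor_power_single)
  next
    case (bracket p a q b)
    then show ?case
      using tensor_power_mult[of a n p b q] tensor_power_mult[of b n q a p]
      by (auto simp: bracket_def add.commute intro: tensor_power_diff)
  qed (auto simp: tensor_power_zero tensor_power_add tensor_power_smult)
qed

section \<open>Right-normed brackets\<close>

text \<open>The linear extension \<open>lin rn\<close> is the right-normed Dynkin operator. The
  empty word gets 0 because L^0 = 0.\<close>

fun rn :: "nat list \<Rightarrow> 'k::{comm_ring, comm_monoid_mult} tensor" where
  "rn [] = 0"
| "rn [x] = gen x"
| "rn (x # y # w) = bracket (gen x) (rn (y # w))"

lemma rn_Cons: "w \<noteq> [] \<Longrightarrow> rn (x # w) = bracket (gen x) (rn w)"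
  by (cases w) simp_all

lemma rn_mem_lie_part:
  "set w \<subseteq> {1..n} \<Longrightarrow> (rn w :: 'k::{comm_ring, comm_monoid_mult} tensor) \<in> lie_part n (length w)"
proof (induction w rule: rn.induct)
  case (3 x y w)
  then have "(rn (x # y # w) :: 'k tensor) \<in> lie_part n (1 + length (y # w))"
    unfolding rn.simps by (intro lie_part_bracket gen_mem_lie_part "3.IH") auto
  then show ?case by simp
qed (simp_all add: lie_part_zero gen_mem_lie_part[simplified])

text \<open>The innermost bracket is [x, x] = 0. This settles n = 1, where the inductive step finds
  no second generator.\<close>

lemma rn_constant: "length w \<ge> 2 \<Longrightarrow> set w \<subseteq> {c} \<Longrightarrow> rn w = 0"
proof (induction w rule: rn.induct)
  case (3 x y w)
  then show ?case by (cases w) (simp_all)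
qed simp_all

text \<open>Encoded as the image of an operator on the tensor power, so that maps commuting with
  this operator visibly preserve it.\<close>

definition rn_span :: "nat \<Rightarrow> nat \<Rightarrow> 'k::{comm_ring, comm_monoid_mult} tensor set" where
  "rn_span n q = lin rn ` tensor_power n q"

lemma rn_span_rn: "set w \<subseteq> {1..n} \<Longrightarrow> length w = q \<Longrightarrow> rn w \<in> rn_span n q"
  unfolding rn_span_def
  by (rule image_eqI[where x = "Poly_Mapping.single w 1"]) (simp_all add: tensor_power_single)

lemma rn_span_zero: "0 \<in> rn_span n q"
  unfolding rn_span_def by (rule image_eqI[where x = 0]) (simp_all add: tensor_power_zero)

lemma rn_span_add: "a \<in> rn_span n q \<Longrightarrow> b \<in> rn_span n q \<Longrightarrow> a + b \<in> rn_span n q"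
  unfolding rn_span_def by (auto simp: tensor_power_add simp flip: lin_add)

lemma rn_span_smult: "a \<in> rn_span n q \<Longrightarrow> smult c a \<in> rn_span n q"
  unfolding rn_span_def by (auto simp: tensor_power_smult simp flip: lin_smult)

lemma rn_span_diff: "a \<in> rn_span n q \<Longrightarrow> b \<in> rn_span n q \<Longrightarrow> a - b \<in> rn_span n q"
  unfolding rn_span_def by (auto simp: tensor_power_diff simp flip: lin_diff)

lemma rn_span_induct [consumes 1, case_names zero rn add]:
  assumes "a \<in> rn_span n q" "P 0"
    and "\<And>w c. length w = q \<Longrightarrow> set w \<subseteq> {1..n} \<Longrightarrow> P (smult c (rn w))"
    and "\<And>a b. P a \<Longrightarrow> P b \<Longrightarrow> P (a + b)"
  shows "P a"
proof -
  obtain b where b: "b \<in> tensor_power n q" "a = lin rn b"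
    using assms(1) by (auto simp: rn_span_def)
  then have "Poly_Mapping.keys b \<subseteq> {w. length w = q \<and> set w \<subseteq> {1..n}}"
    by (auto simp: tensor_power_def)
  then have "P (lin rn b)"
    by (induction rule: tensor_induct_on) (simp_all add: lin_add assms(2-4))
  with b show ?thesis by simp
qed

lemma bracket_gen_rn_span:
  assumes "x \<in> {1..n}" "b \<in> rn_span n q"
  shows "bracket (gen x) b \<in> rn_span n (Suc q)"
  using assms(2)
proof (induction rule: rn_span_induct)
  case (rn w c)
  show ?case
  proof (cases "w = []")
    case False
    then have "bracket (gen x) (smult c (rn w)) = smult c (rn (x # w))"
      by (simp add: rn_Cons bracket_linear)
    then show ?thesis using rn assms(1) by (simp add: rn_span_smult rn_span_rn)
  qed (simp add: rn_span_zero)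
qed (simp_all add: rn_span_zero rn_span_add bracket_linear)

text \<open>By Jacobi, [[x, r], b] = [x, [r, b]] - [r, [x, b]], where r comes from a shorter word.
  The second term applies the induction hypothesis to [x, b], hence \<open>b\<close> and
  \<open>q\<close> are arbitrary.\<close>

lemma bracket_rn_rn_span:
  assumes "set u \<subseteq> {1..n}" "b \<in> rn_span n q"
  shows "bracket (rn u) b \<in> rn_span n (length u + q)"
  using assms
proof (induction u arbitrary: b q rule: rn.induct)
  case (3 x y u)
  have x: "x \<in> {1..n}" and u: "set (y # u) \<subseteq> {1..n}" using "3.prems"(1) by auto
  have "bracket (gen x) (bracket (rn (y # u)) b) \<in> rn_span n (Suc (length (y # u) + q))"
    by (intro bracket_gen_rn_span x "3.IH" u "3.prems")
  moreover have "bracket (rn (y # u)) (bracket (gen x) b) \<in> rn_span n (length (y # u) + Suc q)"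
    by (intro bracket_gen_rn_span x "3.IH" u "3.prems")
  ultimately show ?case by (simp add: bracket_jacobi rn_span_diff)
qed (simp_all add: rn_span_zero bracket_gen_rn_span)

lemma bracket_rn_span:
  assumes "a \<in> rn_span n p" "b \<in> rn_span n q"
  shows "bracket a b \<in> rn_span n (p + q)"
  using assms(1)
proof (induction rule: rn_span_induct)
  case (rn w c)
  then show ?case
    using bracket_rn_rn_span[of w n b q] assms(2) by (simp add: bracket_linear rn_span_smult)
qed (simp_all add: rn_span_zero rn_span_add bracket_linear)

text \<open>The right-normed brackets include the generators, and their span is closed under
  brackets by \<open>bracket_rn_span\<close>.\<close>

lemma lie_part_eq_rn_span: "lie_part n p = (rn_span n p :: 'k::{comm_ring, comm_monoid_mult} tensor set)"
proof (intro equalityI subsetI)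
  fix a :: "'k tensor" assume "a \<in> lie_part n p"
  then have "in_lie_part n p a" by (simp add: lie_part_def)
  then show "a \<in> rn_span n p"
  proof induction
    case (gen i)
    then show ?case using rn_span_rn[of "[i]" n 1] by simp
  qed (simp_all add: rn_span_zero rn_span_add rn_span_smult bracket_rn_span)
next
  fix a :: "'k tensor" assume "a \<in> rn_span n p"
  then show "a \<in> lie_part n p"
    by (induction rule: rn_span_induct)
      (auto simp only: intro: lie_part_closed rn_mem_lie_part)
qed

section \<open>Schur algebras preserve Lie elements\<close>

text \<open>
  The terms of \<open>rn\<close> with their signs; polymorphic so that it can be evaluated at the list of positions
  \<open>[0..<q]\<close>, which exhibits \<open>rn\<close> as the action of an element of the group ring of the symmetric group.
\<close>

fun rn_terms :: "'a list \<Rightarrow> (bool \<times> 'a list) list" where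
  "rn_terms [] = []"
| "rn_terms [x] = [(True, [x])]"
| "rn_terms (x # y # w) = map (\<lambda>(s, z). (s, x # z)) (rn_terms (y # w)) @
     map (\<lambda>(s, z). (\<not> s, z @ [x])) (rn_terms (y # w))"

text \<open>Signs are booleans, so that the list of terms does not involve the coefficient
  ring.\<close>

abbreviation signed :: "bool \<Rightarrow> 'a::uminus \<Rightarrow> 'a" where
  "signed s a \<equiv> if s then a else - a"

text \<open>The expansion treats letters as formal symbols; that of any word can thus be read off
  from that of its positions.\<close>

lemma rn_terms_map: "rn_terms (map f w) = map (\<lambda>(s, z). (s, map f z)) (rn_terms w)"
  by (induction w rule: rn_terms.induct) auto

text \<open>At \<open>[0..<q]\<close> this makes every term a permutation of the positions.\<close>

lemma mset_rn_terms: "(s, z) \<in> set (rn_terms w) \<Longrightarrow> mset z = mset w"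
  by (induction w arbitrary: s z rule: rn_terms.induct) auto

text \<open>Expanding [x, r] = x r - r x puts x in front with the same sign or at the end with the
  opposite one, which gives the two halves of \<open>rn_terms\<close>.\<close>

lemma rn_eq_rn_terms:
  "rn w = (\<Sum>(s, z)\<leftarrow>rn_terms w. signed s (Poly_Mapping.single z (1::'k::{comm_ring, comm_monoid_mult})))"
proof (induction w rule: rn.induct)
  case (3 x y w)
  let ?L = "rn_terms (y # w)"
  have "(gen x :: 'k tensor) * rn (y # w) = (\<Sum>(s, z)\<leftarrow>?L. signed s (Poly_Mapping.single (x # z) 1))"
    unfolding 3 gen_def sum_list_const_mult[symmetric]
    by (intro arg_cong[where f = sum_list] map_cong refl) auto
  moreover have "- (rn (y # w) * gen x :: 'k tensor) = (\<Sum>(s, z)\<leftarrow>?L. signed (\<not> s) (Poly_Mapping.single (z @ [x]) 1))"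
    unfolding 3 gen_def sum_list_mult_const[symmetric] uminus_sum_list_map
    by (intro arg_cong[where f = sum_list] map_cong refl) auto
  ultimately show ?case
    unfolding rn.simps bracket_def by (simp add: o_def case_prod_unfold diff_conv_add_uminus
        del: add_uminus_conv_diff cong: if_cong)
qed (simp_all add: gen_def)

section \<open>The symmetric group acting on right-normed brackets\<close>

lemma perm_action_eq_lin:
  "perm_action \<sigma> a = lin (\<lambda>w. Poly_Mapping.single (permute_list (inv \<sigma>) w) 1) a"
  by (simp add: perm_action_def lin_def)

lemma perm_action_mem_tensor_power:
  assumes "\<sigma> permutes {..<q}" "a \<in> tensor_power n q"
  shows "perm_action \<sigma> a \<in> tensor_power n q"
  unfolding perm_action_eq_lin using assms(2)
proof (rule lin_mem_tensor_power)
  fix w :: "nat list" assume w: "length w = q" "set w \<subseteq> {1..n}"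
  then have "inv \<sigma> permutes {..<length w}" using assms(1) by (simp add: permutes_inv)
  then show "Poly_Mapping.single (permute_list (inv \<sigma>) w) 1 \<in> tensor_power n q"
    using w by (intro tensor_power_single) simp_all
qed

text \<open>Reading a word at the positions \<open>z\<close> permutes it by some \<open>p\<close>;
  \<open>\<sigma>\<close> is the inverse of \<open>p\<close> because \<open>perm_action\<close>
  permutes words by \<open>inv \<sigma>\<close>.\<close>

lemma rearrangement_eq_permute_list:
  assumes "mset z = mset [0..<q]"
  obtains \<sigma> where "\<sigma> permutes {..<q}"
    "\<And>w :: 'a list. length w = q \<Longrightarrow> map ((!) w) z = permute_list (inv \<sigma>) w"
proof -
  obtain p where p: "p permutes {..<q}" "permute_list p [0..<q] = z"
    using mset_eq_permutation[OF assms] by auto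
  have "map ((!) w) z = permute_list (inv (inv p)) w" if "length w = q" for w :: "'a list"
  proof -
    have "map ((!) w) z = permute_list p (map ((!) w) [0..<q])"
      using p by (simp add: permute_list_map)
    also have "map ((!) w) [0..<q] = w" using that map_nth by blast
    finally show ?thesis using p(1) by (simp add: permutes_inv_inv)
  qed
  with permutes_inv[OF p(1)] show thesis by (rule that)
qed

text \<open>The expansion of the word of positions turns into a signed list of permutations, an
  element of the integral group ring whose action is \<open>lin rn\<close> in degree
  \<open>q\<close>, uniformly in \<open>n\<close>.\<close>

lemma rn_as_perm_actions:
  obtains L :: "(bool \<times> (nat \<Rightarrow> nat)) list"
  where "\<And>s \<sigma>. (s, \<sigma>) \<in> set L \<Longrightarrow> \<sigma> permutes {..<q}"
    and "\<And>n a. a \<in> tensor_power n q \<Longrightarrow>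
      lin rn a = (\<Sum>(s, \<sigma>)\<leftarrow>L. signed s (perm_action \<sigma> a :: 'k::{comm_ring, comm_monoid_mult} tensor))"
proof -
  have "\<exists>\<sigma>. \<sigma> permutes {..<q} \<and> (\<forall>w :: nat list. length w = q \<longrightarrow> map ((!) w) z = permute_list (inv \<sigma>) w)"
    if "mset z = mset [0..<q]" for z
    using rearrangement_eq_permute_list[OF that] by blast
  \<comment> \<open>Permutations are chosen for all rearrangements \<open>z\<close> at once, so that
    the choice can be mapped over the list of terms.\<close>
  then obtain \<sigma> where "\<forall>z. mset z = mset [0..<q] \<longrightarrow> \<sigma> z permutes {..<q} \<and>
      (\<forall>w :: nat list. length w = q \<longrightarrow> map ((!) w) z = permute_list (inv (\<sigma> z)) w)"
    using choice[of "\<lambda>z \<sigma>. mset z = mset [0..<q] \<longrightarrow> \<sigma> permutes {..<q} \<and>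
      (\<forall>w :: nat list. length w = q \<longrightarrow> map ((!) w) z = permute_list (inv \<sigma>) w)"] by blast
  then have \<sigma>: "\<And>s z. (s, z) \<in> set (rn_terms [0..<q]) \<Longrightarrow> \<sigma> z permutes {..<q}"
    "\<And>s z w. (s, z) \<in> set (rn_terms [0..<q]) \<Longrightarrow> length w = q \<Longrightarrow>
      map ((!) (w :: nat list)) z = permute_list (inv (\<sigma> z)) w"
    using mset_rn_terms by blast+
  let ?R = "rn_terms [0..<q]"
  let ?L = "map (\<lambda>(s, z). (s, \<sigma> z)) ?R"
  have rn: "rn w = (\<Sum>(s, z)\<leftarrow>?R. signed s (Poly_Mapping.single (permute_list (inv (\<sigma> z)) w) (1::'k)))"
    if "length w = q" for w
  proof -
    have "rn_terms w = map (\<lambda>(s, z). (s, map ((!) w) z)) ?R"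
      using rn_terms_map[of "(!) w" "[0..<q]"] that map_nth[of w] by simp
    then show ?thesis
      unfolding rn_eq_rn_terms using that
      by (auto simp: \<sigma>(2) intro!: arg_cong[where f = sum_list] map_cong)
  qed
  have lin_list: "lin (\<lambda>w. \<Sum>x\<leftarrow>xs. h x w) a = (\<Sum>x\<leftarrow>xs. lin (h x) a)"
    for xs :: "(bool \<times> nat list) list" and h and a :: "'k tensor"
    by (induction xs) (simp_all add: lin_fun_zero lin_fun_add)
  have lin_rn: "lin rn a = (\<Sum>(s, \<sigma>)\<leftarrow>?L. signed s (perm_action \<sigma> a))"
    if "a \<in> tensor_power n q" for n and a :: "'k tensor"
  proof -
    have "lin rn a = lin (\<lambda>w. \<Sum>(s, z)\<leftarrow>?R. signed s (Poly_Mapping.single (permute_list (inv (\<sigma> z)) w) 1)) a"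
      using that by (intro lin_cong rn) (auto simp: tensor_power_def)
    also have "\<dots> = (\<Sum>(s, z)\<leftarrow>?R. signed s (perm_action (\<sigma> z) a))"
      unfolding case_prod_unfold lin_list perm_action_eq_lin
      by (auto simp: lin_fun_minus intro!: arg_cong[where f = sum_list] map_cong)
    finally show ?thesis by (simp add: o_def case_prod_unfold cong: if_cong)
  qed
  show thesis by (rule that[OF _ lin_rn]) (auto simp: \<sigma>(1))
qed

lemma linear_endosD:
  assumes "f \<in> linear_endos U"
  shows "a \<in> U \<Longrightarrow> f a \<in> U" "a \<in> U \<Longrightarrow> b \<in> U \<Longrightarrow> f (a + b) = f a + f b"
    "a \<in> U \<Longrightarrow> f (smult c a) = smult c (f a)" "a \<notin> U \<Longrightarrow> f a = 0" "0 \<in> U \<Longrightarrow> f 0 = 0"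
    "a \<in> U \<Longrightarrow> f (- a) = - f a"
proof -
  show *: "f (smult c a) = smult c (f a)" if "a \<in> U" for a c
    using assms that by (simp add: linear_endos_def)
  show "0 \<in> U \<Longrightarrow> f 0 = 0" using *[of 0 0] by simp
  show "a \<in> U \<Longrightarrow> f (- a) = - f a" using *[of a "-1"] by (simp add: smult_distrib)
qed (use assms in \<open>auto simp: linear_endos_def\<close>)

text \<open>An element of the Schur algebra commutes with each permutation, hence with the signed
  sum of permutations that acts as \<open>lin rn\<close>.\<close>

lemma Schur_lin_rn:
  assumes f: "f \<in> Schur q n" and a: "a \<in> tensor_power n q"
  shows "f (lin rn a) = lin rn (f a)"
proof -
  obtain L where L: "\<And>s \<sigma>. (s, \<sigma>) \<in> set L \<Longrightarrow> \<sigma> permutes {..<q}"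
    "\<And>n a. a \<in> tensor_power n q \<Longrightarrow> lin rn a = (\<Sum>(s, \<sigma>)\<leftarrow>L. signed s (perm_action \<sigma> a :: 'a tensor))"
    using rn_as_perm_actions by blast
  have lf: "f \<in> linear_endos (tensor_power n q)" using f by (simp add: Schur_def)
  \<comment> \<open>Membership of the partial sums is proved along with the equation, because
    additivity of \<open>f\<close> is given only on the tensor power.\<close>
  have "f (\<Sum>(s, \<sigma>)\<leftarrow>L. signed s (perm_action \<sigma> a)) = (\<Sum>(s, \<sigma>)\<leftarrow>L. signed s (perm_action \<sigma> (f a)))
      \<and> (\<Sum>(s, \<sigma>)\<leftarrow>L. signed s (perm_action \<sigma> a)) \<in> tensor_power n q"
    using L(1)
  proof (induction L)
    case Nil
    then show ?case using linear_endosD(5)[OF lf] by (simp add: tensor_power_zero)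
  next
    case (Cons x L)
    obtain s \<sigma> where x: "x = (s, \<sigma>)" by (cases x)
    then have \<sigma>: "\<sigma> permutes {..<q}" using Cons.prems[of s \<sigma>] by simp
    have mem: "perm_action \<sigma> a \<in> tensor_power n q" by (rule perm_action_mem_tensor_power[OF \<sigma> a])
    then have smem: "signed s (perm_action \<sigma> a) \<in> tensor_power n q" by (simp add: tensor_power_minus)
    have "f (perm_action \<sigma> a) = perm_action \<sigma> (f a)" using f \<sigma> a by (simp add: Schur_def)
    then have sf: "f (signed s (perm_action \<sigma> a)) = signed s (perm_action \<sigma> (f a))"
      by (simp add: linear_endosD(6)[OF lf mem])
    have L: "\<tau> permutes {..<q}" if "(t, \<tau>) \<in> set L" for t \<tau>
      using Cons.prems[of t \<tau>] that by simp
    note IH = Cons.IH[THEN conjunct1, OF L] Cons.IH[THEN conjunct2, OF L]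
    show ?case
      using smem IH(2) by (simp only: x list.map sum_list.Cons prod.case sf IH(1)
          linear_endosD(2)[OF lf smem IH(2)] tensor_power_add)
  qed
  then show ?thesis using linear_endosD(1)[OF lf a] by (simp add: L(2)[OF a] L(2))
qed

text \<open>L^q is the image of \<open>lin rn\<close>, and an operator commuting with
  \<open>lin rn\<close> maps this image into itself.\<close>

lemma Schur_lie_part:
  assumes "f \<in> Schur q n" "a \<in> lie_part n q"
  shows "f a \<in> lie_part n q"
proof -
  obtain b where b: "b \<in> tensor_power n q" "a = lin rn b"
    using assms(2) by (auto simp: lie_part_eq_rn_span rn_span_def)
  have "f b \<in> tensor_power n q"
    using assms(1) b(1) by (auto simp: Schur_def linear_endos_def)
  with b show ?thesis
    by (simp add: Schur_lin_rn[OF assms(1) b(1)] lie_part_eq_rn_span rn_span_def)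
qed

section \<open>Derivations\<close>

text \<open>The Leibniz rule on words: the basis values of the derivation of the tensor algebra that
  sends \<open>gen i\<close> to \<open>v i\<close>.\<close>

primrec der_word ::
    "(nat \<Rightarrow> 'k::{comm_ring, comm_monoid_mult} tensor) \<Rightarrow> nat list \<Rightarrow> 'k tensor" where
  "der_word v [] = 0"
| "der_word v (x # w) = v x * Poly_Mapping.single w 1 + gen x * der_word v w"

lemma der_word_append:
  "der_word v (u @ w) = der_word v u * Poly_Mapping.single w 1 + Poly_Mapping.single u 1 * der_word v w"
  by (induction u) (simp_all add: gen_def algebra_simps)

text \<open>Both sides are bilinear, which leaves the case of two words, that is,
  \<open>der_word_append\<close> with scalars collected.\<close>

lemma lin_der_word_mult:
  "lin (der_word v) (a * b) = lin (der_word v) a * b + a * lin (der_word v) b"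
proof (induction a rule: tensor_induct)
  case (single u c)
  show ?case
  proof (induction b rule: tensor_induct)
    case (single w d)
    have "smult c (der_word v u) * Poly_Mapping.single w d = smult (c * d) (der_word v u * Poly_Mapping.single w 1)"
      using smult_mult_right[of "smult c (der_word v u)" d "Poly_Mapping.single w 1"]
      by (simp add: smult_mult_left mult.commute)
    moreover have "Poly_Mapping.single u c * smult d (der_word v w) = smult (c * d) (Poly_Mapping.single u 1 * der_word v w)"
      using smult_mult_left[of c "Poly_Mapping.single u 1" "smult d (der_word v w)"]
      by (simp add: smult_mult_right)
    ultimately show ?case by (simp add: der_word_append smult_distrib)
  qed (simp_all add: lin_add algebra_simps)
qed (simp_all add: lin_add algebra_simps)

section \<open>Derivations of the free Lie algebra\<close>

lemma DerD:
  assumes "D \<in> Der n"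
  shows Der_mem: "D a \<in> free_lie n"
    and Der_add_arg: "a \<in> free_lie n \<Longrightarrow> b \<in> free_lie n \<Longrightarrow> D (a + b) = D a + D b"
    and Der_smult_arg: "a \<in> free_lie n \<Longrightarrow> D (smult c a) = smult c (D a)"
    and Der_outside: "a \<notin> free_lie n \<Longrightarrow> D a = 0"
    and Der_zero_arg: "D 0 = 0"
    and Der_bracket_arg: "a \<in> free_lie n \<Longrightarrow> b \<in> free_lie n \<Longrightarrow>
      D (bracket a b) = bracket (D a) b + bracket a (D b)"
proof -
  have "D \<in> linear_endos (free_lie n)" using assms by (simp add: Der_def)
  note linD = linear_endosD[OF this]
  show "D a \<in> free_lie n" by (cases "a \<in> free_lie n") (simp_all add: linD free_lie.zero)
  show "D 0 = 0" by (rule linD(5)[OF free_lie.zero])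
  show "a \<in> free_lie n \<Longrightarrow> b \<in> free_lie n \<Longrightarrow> D (bracket a b) = bracket (D a) b + bracket a (D b)"
    using assms by (simp add: Der_def)
  show "a \<in> free_lie n \<Longrightarrow> b \<in> free_lie n \<Longrightarrow> D (a + b) = D a + D b"
    "a \<in> free_lie n \<Longrightarrow> D (smult c a) = smult c (D a)" "a \<notin> free_lie n \<Longrightarrow> D a = 0"
    by (fact linD)+
qed

lemma DerI:
  assumes "\<And>a. a \<in> free_lie n \<Longrightarrow> D a \<in> free_lie n"
    and "\<And>a b. a \<in> free_lie n \<Longrightarrow> b \<in> free_lie n \<Longrightarrow> D (a + b) = D a + D b"
    and "\<And>c a. a \<in> free_lie n \<Longrightarrow> D (smult c a) = smult c (D a)"
    and "\<And>a. a \<notin> free_lie n \<Longrightarrow> D a = 0"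
    and "\<And>a b. a \<in> free_lie n \<Longrightarrow> b \<in> free_lie n \<Longrightarrow>
      D (bracket a b) = bracket (D a) b + bracket a (D b)"
  shows "D \<in> Der n"
  using assms by (simp add: Der_def linear_endos_def)

lemma Der_sum_arg:
  assumes "D \<in> Der n" "\<And>x. x \<in> A \<Longrightarrow> h x \<in> free_lie n"
  shows "D (\<Sum>x\<in>A. h x) = (\<Sum>x\<in>A. D (h x)) \<and> (\<Sum>x\<in>A. h x) \<in> free_lie n"
  using assms(2)
  by (induction A rule: infinite_finite_induct)
    (simp_all add: Der_zero_arg[OF assms(1)] Der_add_arg[OF assms(1)] free_lie.zero free_lie.add)

text \<open>The \<open>gen i\<close> generate the free Lie algebra, and outside it both maps are 0,
  so they agree as functions.\<close>

lemma Der_eqI: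
  assumes D: "D \<in> Der n" "D' \<in> Der n" and eq: "\<And>i. i \<in> {1..n} \<Longrightarrow> D (gen i) = D' (gen i)"
  shows "D = D'"
proof
  fix a show "D a = D' a"
  proof (cases "a \<in> free_lie n")
    case True
    then show ?thesis by induction (simp_all add: eq DerD[OF D(1)] DerD[OF D(2)])
  qed (simp add: DerD[OF D(1)] DerD[OF D(2)])
qed

text \<open>A derivation of the tensor algebra also obeys the Leibniz rule for commutators, and it
  preserves Lie elements once its values on the generators are Lie elements. Its restriction,
  extended by 0, is the witness.\<close>

lemma Der_of_values_exists:
  assumes v: "\<And>i. i \<in> {1..n} \<Longrightarrow> v i \<in> free_lie n"
  shows "\<exists>D \<in> Der n. \<forall>i \<in> {1..n}. D (gen i) = v i"
proof
  let ?D = "\<lambda>a. if a \<in> free_lie n then lin (der_word v) a else 0"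
  have gen: "lin (der_word v) (gen i) = v i" for i by (simp add: gen_def)
  have bracket: "lin (der_word v) (bracket a b) =
      bracket (lin (der_word v) a) b + bracket a (lin (der_word v) b)" for a b
    by (simp add: bracket_def lin_diff lin_der_word_mult)
  have mem: "lin (der_word v) a \<in> free_lie n" if "a \<in> free_lie n" for a
    using that
    by induction (auto simp: gen v lin_add lin_smult bracket intro: free_lie.intros)
  show "?D \<in> Der n"
    by (rule DerI) (simp_all add: mem lin_add lin_smult bracket free_lie.add free_lie.smult free_lie.bracket)
  show "\<forall>i \<in> {1..n}. ?D (gen i) = v i" by (simp add: free_lie.gen gen)
qed

lemma der_of_eqI: "D \<in> Der n \<Longrightarrow> (\<And>i. i \<in> {1..n} \<Longrightarrow> D (gen i) = v i) \<Longrightarrow> der_of n v = D"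
  unfolding der_of_def by (rule the_equality) (auto intro: Der_eqI)

lemma
  assumes "\<And>i. i \<in> {1..n} \<Longrightarrow> v i \<in> free_lie n"
  shows der_of_mem_Der: "der_of n v \<in> Der n"
    and der_of_gen: "i \<in> {1..n} \<Longrightarrow> der_of n v (gen i) = v i"
proof -
  obtain D where D: "D \<in> Der n" "\<And>i. i \<in> {1..n} \<Longrightarrow> D (gen i) = v i"
    using Der_of_values_exists[of n v] assms by blast
  have "der_of n v = D" by (rule der_of_eqI[OF D])
  with D show "der_of n v \<in> Der n" "i \<in> {1..n} \<Longrightarrow> der_of n v (gen i) = v i" by simp_all
qed

lemma der_of_cong: "(\<And>i. i \<in> {1..n} \<Longrightarrow> v i = v' i) \<Longrightarrow> der_of n v = der_of n v'"
  unfolding der_of_def by (intro arg_cong[where f = The] ext) auto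

lemma der_of_mem_Der_deg:
  assumes "\<And>i. i \<in> {1..n} \<Longrightarrow> v i \<in> lie_part n q"
  shows "der_of n v \<in> Der_deg n q"
proof -
  have v: "v i \<in> free_lie n" if "i \<in> {1..n}" for i
    using assms[OF that] lie_part_subset_free_lie by blast
  show ?thesis
    unfolding Der_deg_def using der_of_mem_Der[OF v] der_of_gen[OF v] assms by simp
qed

lemma Der_zero: "(\<lambda>_. 0) \<in> Der n"
  by (rule DerI) (simp_all add: free_lie.zero)

lemma Der_add: "D \<in> Der n \<Longrightarrow> D' \<in> Der n \<Longrightarrow> (\<lambda>a. D a + D' a) \<in> Der n"
  by (rule DerI) (simp_all add: DerD[of D n] DerD[of D' n] free_lie.add smult_distrib bracket_linear algebra_simps)

lemma Der_smult: "D \<in> Der n \<Longrightarrow> (\<lambda>a. smult c (D a)) \<in> Der n"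
  by (rule DerI) (simp_all add: DerD[of D n] free_lie.smult smult_distrib bracket_linear mult.commute)

lemma Der_der_bracket: "D \<in> Der n \<Longrightarrow> D' \<in> Der n \<Longrightarrow> der_bracket D D' \<in> Der n"
  unfolding der_bracket_def
  by (rule DerI) (simp_all add: DerD[of D n] DerD[of D' n] free_lie_diff free_lie.bracket smult_distrib bracket_linear)

section \<open>Graded pieces of the derivations\<close>

lemma Der_deg_subset_Der: "Der_deg n p \<subseteq> Der n"
  by (auto simp: Der_deg_def)

lemma Der_deg_zero: "(\<lambda>_. 0) \<in> Der_deg n p"
  by (simp add: Der_deg_def Der_zero lie_part_zero)

lemma Der_deg_add: "D \<in> Der_deg n p \<Longrightarrow> D' \<in> Der_deg n p \<Longrightarrow> (\<lambda>a. D a + D' a) \<in> Der_deg n p"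
  by (simp add: Der_deg_def Der_add lie_part_add)

lemma Der_deg_smult: "D \<in> Der_deg n p \<Longrightarrow> (\<lambda>a. smult c (D a)) \<in> Der_deg n p"
  by (simp add: Der_deg_def Der_smult lie_part_smult)

text \<open>One letter at a time is replaced by a Lie element of length \<open>p\<close>, which
  turns length \<open>q\<close> into \<open>p + q - 1\<close>. The bound \<open>p \<ge> 1\<close>
  keeps the subtraction of naturals exact.\<close>

lemma Der_deg_lie_part:
  assumes D: "D \<in> Der_deg n p" and p: "p \<ge> 1" and a: "a \<in> lie_part n q"
  shows "D a \<in> lie_part n (p + q - 1)"
proof -
  have DD: "D \<in> Der n" using D by (simp add: Der_deg_def)
  note lie_part_free = lie_part_subset_free_lie[unfolded lie_part_def, THEN subsetD, simplified]
  from a have "in_lie_part n q a" by (simp add: lie_part_def)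
  then show ?thesis
  proof induction
    case (gen i)
    then show ?case using D by (simp add: Der_deg_def)
  next
    case (bracket q a r b)
    have "bracket (D a) b \<in> lie_part n (p + q - 1 + r)" "bracket a (D b) \<in> lie_part n (q + (p + r - 1))"
      using bracket by (auto simp: lie_part_def intro: in_lie_part.bracket)
    moreover have "p + q - 1 + r = p + (q + r) - 1" "q + (p + r - 1) = p + (q + r) - 1"
      using p by simp_all
    ultimately show ?case
      using bracket.hyps by (simp add: DerD[OF DD] lie_part_free lie_part_add)
  qed (simp_all add: DerD[OF DD] lie_part_free lie_part_zero lie_part_add lie_part_smult)
qed

lemma Der_deg_der_bracket:
  assumes D: "D \<in> Der_deg n p" and D': "D' \<in> Der_deg n q" and "p \<ge> 1" "q \<ge> 1"
  shows "der_bracket D D' \<in> Der_deg n (p + q - 1)"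
proof -
  have "der_bracket D D' (gen i) \<in> lie_part n (p + q - 1)" if i: "i \<in> {1..n}" for i
  proof -
    have "D (gen i) \<in> lie_part n p" "D' (gen i) \<in> lie_part n q"
      using D D' i by (auto simp: Der_deg_def)
    then have "D (D' (gen i)) \<in> lie_part n (p + q - 1)" "D' (D (gen i)) \<in> lie_part n (q + p - 1)"
      by (blast intro: Der_deg_lie_part[OF D \<open>p \<ge> 1\<close>] Der_deg_lie_part[OF D' \<open>q \<ge> 1\<close>])+
    then show ?thesis
      unfolding der_bracket_def by (intro lie_part_diff) (simp_all add: add.commute)
  qed
  then show ?thesis using D D' by (simp add: Der_deg_def Der_der_bracket)
qed

section \<open>The Lie algebra of derivations of degree at least two\<close>

lemma Der_starI:
  "finite P \<Longrightarrow> P \<subseteq> {2..} \<Longrightarrow> (\<And>p. p \<in> P \<Longrightarrow> D p \<in> Der_deg n p) \<Longrightarrow> (\<lambda>a. \<Sum>p\<in>P. D p a) \<in> Der_star n"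
  unfolding Der_star_def by blast

lemma Der_starE:
  assumes "E \<in> Der_star n"
  obtains P D where "finite P" "P \<subseteq> {2..}" "\<And>p. p \<in> P \<Longrightarrow> D p \<in> Der_deg n p" "E = (\<lambda>a. \<Sum>p\<in>P. D p a)"
  using assms unfolding Der_star_def by blast

lemma Der_deg_subset_Der_star: "p \<ge> 2 \<Longrightarrow> Der_deg n p \<subseteq> Der_star n"
  using Der_starI[of "{p}" "\<lambda>_. D" n for D] by auto

lemma Der_star_zero: "(\<lambda>_. 0) \<in> Der_star n"
  using Der_starI[of "{}"] by simp

lemma Der_star_add:
  assumes "E \<in> Der_star n" "E' \<in> Der_star n"
  shows "(\<lambda>a. E a + E' a) \<in> Der_star n"
proof -
  obtain P D where P: "finite P" "P \<subseteq> {2..}" "\<And>p. p \<in> P \<Longrightarrow> D p \<in> Der_deg n p" "E = (\<lambda>a. \<Sum>p\<in>P. D p a)"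
    using Der_starE[OF assms(1)] by blast
  obtain Q D' where Q: "finite Q" "Q \<subseteq> {2..}" "\<And>p. p \<in> Q \<Longrightarrow> D' p \<in> Der_deg n p" "E' = (\<lambda>a. \<Sum>p\<in>Q. D' p a)"
    using Der_starE[OF assms(2)] by blast
  \<comment> \<open>Both families are padded with zero derivations, so that the two sums run over
    \<open>P \<union> Q\<close>.\<close>
  define F where "F p = (if p \<in> P then D p else (\<lambda>_. 0))" for p
  define F' where "F' p = (if p \<in> Q then D' p else (\<lambda>_. 0))" for p
  have "E = (\<lambda>a. \<Sum>p\<in>P \<union> Q. F p a)"
    unfolding P(4) by (intro ext sum.mono_neutral_cong_left) (auto simp: F_def P(1) Q(1))
  moreover have "E' = (\<lambda>a. \<Sum>p\<in>P \<union> Q. F' p a)"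
    unfolding Q(4) by (intro ext sum.mono_neutral_cong_left) (auto simp: F'_def P(1) Q(1))
  ultimately have "(\<lambda>a. E a + E' a) = (\<lambda>a. \<Sum>p\<in>P \<union> Q. F p a + F' p a)"
    by (simp add: sum.distrib)
  moreover have "(\<lambda>a. \<Sum>p\<in>P \<union> Q. F p a + F' p a) \<in> Der_star n"
    using P Q by (intro Der_starI Der_deg_add) (auto simp: F_def F'_def Der_deg_zero)
  ultimately show ?thesis by simp
qed

lemma Der_star_smult:
  assumes "E \<in> Der_star n"
  shows "(\<lambda>a. smult c (E a)) \<in> Der_star n"
proof -
  obtain P D where P: "finite P" "P \<subseteq> {2..}" "\<And>p. p \<in> P \<Longrightarrow> D p \<in> Der_deg n p" "E = (\<lambda>a. \<Sum>p\<in>P. D p a)"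
    using Der_starE[OF assms] by blast
  show ?thesis unfolding P(4) smult_sum by (intro Der_starI Der_deg_smult P)
qed

text \<open>A sum over an infinite index set is 0 by convention, which the first assumption
  covers.\<close>

lemma subspace_sum:
  assumes "(\<lambda>_. 0) \<in> S" "\<And>D D'. D \<in> S \<Longrightarrow> D' \<in> S \<Longrightarrow> (\<lambda>a. D a + D' a) \<in> S"
    and "\<And>x. x \<in> A \<Longrightarrow> h x \<in> S"
  shows "(\<lambda>a. \<Sum>x\<in>A. h x a) \<in> S"
  using assms(3) by (induction A rule: infinite_finite_induct) (simp_all add: assms(1,2))

lemma Der_star_der_bracket:
  assumes "E \<in> Der_star n" "E' \<in> Der_star n"
  shows "der_bracket E E' \<in> Der_star n"
proof -
  obtain P D where P: "finite P" "P \<subseteq> {2..}" "\<And>p. p \<in> P \<Longrightarrow> D p \<in> Der_deg n p" "E = (\<lambda>a. \<Sum>p\<in>P. D p a)"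
    using Der_starE[OF assms(1)] by blast
  obtain Q D' where Q: "finite Q" "Q \<subseteq> {2..}" "\<And>p. p \<in> Q \<Longrightarrow> D' p \<in> Der_deg n p" "E' = (\<lambda>a. \<Sum>p\<in>Q. D' p a)"
    using Der_starE[OF assms(2)] by blast
  have D: "D p \<in> Der n" if "p \<in> P" for p using P(3)[OF that] Der_deg_subset_Der by blast
  have D': "D' q \<in> Der n" if "q \<in> Q" for q using Q(3)[OF that] Der_deg_subset_Der by blast
  \<comment> \<open>Derivations are additive on Lie elements, and \<open>D' q a\<close> is one for
    every \<open>a\<close>, since it is 0 when \<open>a\<close> is not a Lie element.\<close>
  have "D p (\<Sum>q\<in>Q. D' q a) = (\<Sum>q\<in>Q. D p (D' q a))" if "p \<in> P" for p a
    using Der_sum_arg[OF D[OF that], of Q "\<lambda>q. D' q a"] Der_mem[OF D'] by blast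
  moreover have "D' q (\<Sum>p\<in>P. D p a) = (\<Sum>p\<in>P. D' q (D p a))" if "q \<in> Q" for q a
    using Der_sum_arg[OF D'[OF that], of P "\<lambda>p. D p a"] Der_mem[OF D] by blast
  ultimately have "der_bracket E E' = (\<lambda>a. (\<Sum>p\<in>P. \<Sum>q\<in>Q. D p (D' q a)) - (\<Sum>q\<in>Q. \<Sum>p\<in>P. D' q (D p a)))"
    by (simp add: der_bracket_def P(4) Q(4))
  also have "\<dots> = (\<lambda>a. \<Sum>p\<in>P. \<Sum>q\<in>Q. der_bracket (D p) (D' q) a)"
    unfolding der_bracket_def sum_subtractf by (subst sum.swap) (rule refl)
  also have "\<dots> \<in> Der_star n"
  proof (intro subspace_sum Der_star_zero Der_star_add)
    fix p q assume pq: "p \<in> P" "q \<in> Q"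
    then have ge: "p \<ge> 2" "q \<ge> 2" using P(2) Q(2) by auto
    then have "der_bracket (D p) (D' q) \<in> Der_deg n (p + q - 1)"
      using pq by (intro Der_deg_der_bracket P Q) simp_all
    moreover have "p + q - 1 \<ge> 2" using ge by simp
    ultimately show "der_bracket (D p) (D' q) \<in> Der_star n"
      using Der_deg_subset_Der_star by blast
  qed
  finally show ?thesis .
qed

lemma lie_subalgebra_Der_star_Der_star: "lie_subalgebra_Der_star n (Der_star n)"
  by (simp add: lie_subalgebra_Der_star_def Der_star_zero Der_star_add Der_star_smult Der_star_der_bracket)

text \<open>Elements of the Schur algebra preserve L^q, so \<open>Phi n f\<close> maps
  \<open>Der_deg n q\<close> into itself.\<close>

lemma Schur_invariant_Der_star:
  "Schur_invariant n (Der_star n :: ('k::{comm_ring, comm_monoid_mult} tensor \<Rightarrow> 'k tensor) set)"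
proof -
  have "Phi n f \<theta> \<in> Der_star n" if "q \<ge> 2" "f \<in> Schur q n" "\<theta> \<in> Der_deg n q"
    for q f and \<theta> :: "'k tensor \<Rightarrow> 'k tensor"
  proof -
    have "\<theta> (gen i) \<in> lie_part n q" if "i \<in> {1..n}" for i
      using \<open>\<theta> \<in> Der_deg n q\<close> that by (simp add: Der_deg_def)
    then have "Phi n f \<theta> \<in> Der_deg n q"
      unfolding Phi_def by (intro der_of_mem_Der_deg Schur_lie_part[OF \<open>f \<in> Schur q n\<close>])
    then show ?thesis using Der_deg_subset_Der_star[OF that(1)] by blast
  qed
  then show ?thesis unfolding Schur_invariant_def by blast
qed

section \<open>Derivations supported on one generator\<close>

lemma bracket_gen_mem_lie_part: "s \<in> {1..n} \<Longrightarrow> t \<in> {1..n} \<Longrightarrow> bracket (gen s) (gen t) \<in> lie_part n 2"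
  using lie_part_bracket[OF gen_mem_lie_part gen_mem_lie_part, of s n t] by (simp add: numeral_2_eq_2)

text \<open>This is D(i, a) of the outline. Both families in \<open>M_tilde\<close> have this form,
  with a bracket of two generators as value.\<close>

definition der_single ::
    "nat \<Rightarrow> nat \<Rightarrow> 'k::{comm_ring, comm_monoid_mult} tensor \<Rightarrow> 'k tensor \<Rightarrow> 'k tensor" where
  "der_single n i a = der_of n (\<lambda>k. if k = i then a else 0)"

lemma der_single_mem_Der_deg: "a \<in> lie_part n q \<Longrightarrow> der_single n i a \<in> Der_deg n q"
  unfolding der_single_def by (rule der_of_mem_Der_deg) (simp add: lie_part_zero)

lemma der_single_gen:
  "a \<in> lie_part n q \<Longrightarrow> k \<in> {1..n} \<Longrightarrow> der_single n i a (gen k) = (if k = i then a else 0)"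
  unfolding der_single_def using lie_part_subset_free_lie[of n q]
  by (subst der_of_gen) (auto intro: free_lie.zero)

lemma der_single_eqI:
  "D \<in> Der n \<Longrightarrow> (\<And>k. k \<in> {1..n} \<Longrightarrow> D (gen k) = (if k = i then a else 0)) \<Longrightarrow> der_single n i a = D"
  unfolding der_single_def by (rule der_of_eqI)

lemma der_single_zero: "der_single n i 0 = (\<lambda>_. 0)"
  by (rule der_single_eqI) (simp_all add: Der_zero)

lemma der_single_add:
  "a \<in> lie_part n q \<Longrightarrow> b \<in> lie_part n q \<Longrightarrow>
    der_single n i (a + b) = (\<lambda>x. der_single n i a x + der_single n i b x)"
  using der_single_mem_Der_deg[of a n q i] der_single_mem_Der_deg[of b n q i] Der_deg_subset_Der[of n q]
  by (intro der_single_eqI Der_add) (auto simp: der_single_gen)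

lemma der_single_smult:
  "a \<in> lie_part n q \<Longrightarrow> der_single n i (smult c a) = (\<lambda>x. smult c (der_single n i a x))"
  using der_single_mem_Der_deg[of a n q i] Der_deg_subset_Der[of n q]
  by (intro der_single_eqI Der_smult) (auto simp: der_single_gen)

lemma chi_tilde_eq: "chi_tilde n i j = der_single n i (bracket (gen i) (gen j))"
  by (simp add: chi_tilde_def der_single_def)

lemma theta_tilde_eq: "theta_tilde n i s t = der_single n i (bracket (gen s) (gen t))"
  by (simp add: theta_tilde_def der_single_def)

lemma M_tilde_subset_Der_star: "M_tilde n \<subseteq> Der_star n"
proof -
  have "der_single n i (bracket (gen s) (gen t)) \<in> Der_star n" if "s \<in> {1..n}" "t \<in> {1..n}" for i s t
    using der_single_mem_Der_deg[OF bracket_gen_mem_lie_part[OF that]] Der_deg_subset_Der_star[of 2 n]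
    by blast
  then show ?thesis unfolding M_tilde_def chi_tilde_eq theta_tilde_eq by blast
qed

section \<open>Weight projections\<close>

text \<open>The grading by a single letter, which separates the two values of the bracket of
  derivations in \<open>rn_step\<close>. Zero has every degree.\<close>

definition homogeneous :: "nat \<Rightarrow> nat \<Rightarrow> 'k::{comm_ring, comm_monoid_mult} tensor set" where
  "homogeneous i c = {a. \<forall>w\<in>Poly_Mapping.keys a. count (mset w) i = c}"

lemma homogeneous_zero: "0 \<in> homogeneous i c"
  by (simp add: homogeneous_def)

lemma homogeneous_add: "a \<in> homogeneous i c \<Longrightarrow> b \<in> homogeneous i c \<Longrightarrow> a + b \<in> homogeneous i c"
  using keys_add[of a b] by (fastforce simp: homogeneous_def)

lemma homogeneous_diff: "a \<in> homogeneous i c \<Longrightarrow> b \<in> homogeneous i c \<Longrightarrow> a - b \<in> homogeneous i c"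
  using keys_diff_subset[of a b] by (fastforce simp: homogeneous_def)

lemma homogeneous_mult: "a \<in> homogeneous i c \<Longrightarrow> b \<in> homogeneous i d \<Longrightarrow> a * b \<in> homogeneous i (c + d)"
  using keys_mult_words[of a b] by (fastforce simp: homogeneous_def)

lemma homogeneous_bracket:
  "a \<in> homogeneous i c \<Longrightarrow> b \<in> homogeneous i d \<Longrightarrow> bracket a b \<in> homogeneous i (c + d)"
  using homogeneous_mult[of a i c b d] homogeneous_mult[of b i d a c]
  by (simp add: bracket_def homogeneous_diff add.commute)

lemma homogeneous_gen: "gen x \<in> homogeneous i (count {#x#} i)"
  by (simp add: homogeneous_def gen_def)

lemma homogeneous_rn: "rn w \<in> homogeneous i (count (mset w) i)"
proof (induction w rule: rn.induct)
  case (3 x y w)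
  then show ?case using homogeneous_bracket[OF homogeneous_gen[of x i] 3] by (simp split: if_splits)
next
  case (2 x)
  then show ?case using homogeneous_gen[of x i] by simp
qed (simp add: homogeneous_zero)

text \<open>An occurrence of x_i is replaced by [x_i, x_k], which contains x_i exactly once as
  \<open>i \<noteq> k\<close>; so the degree in x_i does not change.\<close>

lemma homogeneous_der_single_rn:
  assumes "i \<noteq> k" "i \<in> {1..n}" "k \<in> {1..n}" "set w \<subseteq> {1..n}"
  shows "der_single n i (bracket (gen i) (gen k)) (rn w) \<in>
    (homogeneous i (count (mset w) i) :: 'k::{comm_ring, comm_monoid_mult} tensor set)"
  using assms(4)
proof (induction w rule: rn.induct)
  case 1
  have "der_single n i (bracket (gen i) (gen k) :: 'k tensor) \<in> Der n"
    using der_single_mem_Der_deg[OF bracket_gen_mem_lie_part[OF assms(2,3)]] Der_deg_subset_Der by blast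
  then show ?case by (simp add: Der_zero_arg homogeneous_zero)
next
  case (2 x)
  then show ?case
    using homogeneous_bracket[OF homogeneous_gen[of i i] homogeneous_gen[of k i], where 'a = 'k] assms(1)
    by (auto simp: der_single_gen[OF bracket_gen_mem_lie_part[OF assms(2,3)]] homogeneous_zero)
next
  case (3 x y w)
  let ?D = "der_single n i (bracket (gen i) (gen k) :: 'k tensor)"
  have D: "?D \<in> Der n"
    using der_single_mem_Der_deg[OF bracket_gen_mem_lie_part[OF assms(2,3)], of i] Der_deg_subset_Der by blast
  have x: "x \<in> {1..n}" and w: "set (y # w) \<subseteq> {1..n}" using "3.prems" by auto
  have rn: "rn (y # w) \<in> (free_lie n :: 'k tensor set)"
    using rn_mem_lie_part[OF w] lie_part_subset_free_lie by blast
  have Dx: "?D (gen x) \<in> homogeneous i (count {#x#} i)"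
    using homogeneous_bracket[OF homogeneous_gen[of i i] homogeneous_gen[of k i], where 'a = 'k] assms(1)
    by (simp add: der_single_gen[OF bracket_gen_mem_lie_part[OF assms(2,3)] x] homogeneous_zero)
  have "?D (rn (x # y # w)) = bracket (?D (gen x)) (rn (y # w)) + bracket (gen x) (?D (rn (y # w)))"
    unfolding rn.simps by (rule Der_bracket_arg[OF D free_lie.gen[OF x] rn])
  also have "\<dots> \<in> homogeneous i (count {#x#} i + count (mset (y # w)) i)"
    by (intro homogeneous_add homogeneous_bracket Dx homogeneous_rn homogeneous_gen "3.IH" w)
  finally show ?case by (simp split: if_splits)
qed

section \<open>Renaming letters and the associated Schur maps\<close>

lemma lin_map_mult:
  "lin (\<lambda>w. Poly_Mapping.single (map \<pi> w) 1) (a * b) =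
    lin (\<lambda>w. Poly_Mapping.single (map \<pi> w) 1) a * lin (\<lambda>w. Poly_Mapping.single (map \<pi> w) 1) b"
proof (induction a rule: tensor_induct)
  case (single u c)
  show ?case by (induction b rule: tensor_induct) (simp_all add: lin_add algebra_simps)
qed (simp_all add: lin_add algebra_simps)

lemma lin_map_rn: "lin (\<lambda>w. Poly_Mapping.single (map \<pi> w) 1) (rn w) = rn (map \<pi> w)"
  by (induction w rule: rn.induct) (simp_all add: bracket_def lin_diff lin_map_mult gen_def)

text \<open>The projection is to isolate one value of a bracket of derivations, and the renaming to
  change its leading letter. The value 0 outside the tensor power is what
  \<open>linear_endos\<close> demands.\<close>

definition weight_rename ::
    "nat \<Rightarrow> nat \<Rightarrow> nat \<Rightarrow> nat \<Rightarrow> (nat \<Rightarrow> nat) \<Rightarrow> 'k::{comm_ring, comm_monoid_mult} tensor \<Rightarrow> 'k tensor" where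
  "weight_rename n q i c \<pi> a = (if a \<in> tensor_power n q
     then lin (\<lambda>w. if count (mset w) i = c then Poly_Mapping.single (map \<pi> w) 1 else 0) a else 0)"

text \<open>Permuting positions does not change how often a letter occurs, and it commutes with any
  letterwise map.\<close>

lemma weight_rename_mem_Schur:
  assumes \<pi>: "\<And>x. x \<in> {1..n} \<Longrightarrow> \<pi> x \<in> {1..n}"
  shows "(weight_rename n q i c \<pi> :: 'k::{comm_ring, comm_monoid_mult} tensor \<Rightarrow> 'k tensor) \<in> Schur q n"
proof -
  let ?g = "\<lambda>w. if count (mset w) i = c then Poly_Mapping.single (map \<pi> w) (1 :: 'k) else 0"
  have mem: "lin ?g a \<in> tensor_power n q" if "a \<in> tensor_power n q" for a :: "'k tensor"
    using that
  proof (rule lin_mem_tensor_power)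
    fix w :: "nat list" assume "length w = q" "set w \<subseteq> {1..n}"
    moreover from this have "set (map \<pi> w) \<subseteq> {1..n}" using \<pi> by (simp only: set_map) blast
    ultimately show "?g w \<in> tensor_power n q"
      by (simp add: tensor_power_zero tensor_power_single del: set_map)
  qed
  have comm: "lin ?g (perm_action \<sigma> a) = perm_action \<sigma> (lin ?g a)"
    if "\<sigma> permutes {..<q}" "a \<in> tensor_power n q" for \<sigma> and a :: "'k tensor"
    unfolding perm_action_eq_lin lin_lin
  proof (rule lin_cong)
    fix w assume "w \<in> Poly_Mapping.keys a"
    then have "inv \<sigma> permutes {..<length w}"
      using that by (auto simp: tensor_power_def permutes_inv)
    then show "lin ?g (Poly_Mapping.single (permute_list (inv \<sigma>) w) 1) =
        lin (\<lambda>w. Poly_Mapping.single (permute_list (inv \<sigma>) w) 1) (?g w)"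
      by (simp add: permute_list_map)
  qed
  show ?thesis
    unfolding Schur_def linear_endos_def
    by (auto simp: weight_rename_def mem comm perm_action_mem_tensor_power tensor_power_add
        tensor_power_smult lin_add lin_smult)
qed

lemma weight_rename_homogeneous:
  assumes "a \<in> homogeneous i d"
  shows "a \<in> tensor_power n q \<Longrightarrow> d = c \<Longrightarrow>
      weight_rename n q i c \<pi> a = lin (\<lambda>w. Poly_Mapping.single (map \<pi> w) 1) a"
    and "d \<noteq> c \<Longrightarrow> weight_rename n q i c \<pi> a = 0"
proof -
  let ?g = "\<lambda>w. if count (mset w) i = c then Poly_Mapping.single (map \<pi> w) 1 else 0"
  have "lin ?g a = lin (\<lambda>w. Poly_Mapping.single (map \<pi> w) 1) a" if "d = c"
    using assms that by (intro lin_cong) (simp add: homogeneous_def)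
  then show "a \<in> tensor_power n q \<Longrightarrow> d = c \<Longrightarrow>
      weight_rename n q i c \<pi> a = lin (\<lambda>w. Poly_Mapping.single (map \<pi> w) 1) a"
    by (simp add: weight_rename_def)
  have "lin ?g a = lin (\<lambda>w. 0) a" if "d \<noteq> c"
    using assms that by (intro lin_cong) (simp add: homogeneous_def)
  then show "d \<noteq> c \<Longrightarrow> weight_rename n q i c \<pi> a = 0"
    by (simp add: weight_rename_def lin_fun_zero)
qed

section \<open>Generating all derivations of degree at least two\<close>

text \<open>The bracket \<open>?B\<close> has the value [x_i, rn u] at x_i, a value of degree one
  less in x_i at x_k, and 0 elsewhere. The Schur map \<open>?f\<close> kills the second value and
  turns the first into \<open>rn (j # w)\<close>.\<close>

lemma rn_step:
  fixes S :: "('k::{comm_ring, comm_monoid_mult} tensor \<Rightarrow> 'k tensor) set"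
  assumes S: "\<And>D D'. D \<in> S \<Longrightarrow> D' \<in> S \<Longrightarrow> der_bracket D D' \<in> S" "Schur_invariant n S"
    and ijk: "i \<in> {1..n}" "j \<in> {1..n}" "k \<in> {1..n}" "i \<noteq> k"
    and w: "set w \<subseteq> {1..n}" "length w \<ge> 2"
    and mem: "der_single n i (bracket (gen i) (gen k)) \<in> S"
      "der_single n k (rn (map (Transposition.transpose i j) w)) \<in> S"
  shows "der_single n i (rn (j # w)) \<in> S"
proof -
  let ?\<pi> = "Transposition.transpose i j"
  \<comment> \<open>The transposition is an involution: renaming \<open>u\<close> gives back
    \<open>w\<close>, while a letter \<open>i\<close> put in front of \<open>u\<close> becomes
    \<open>j\<close>.\<close>
  define u where "u = map ?\<pi> w"
  have \<pi>: "?\<pi> x \<in> {1..n}" if "x \<in> {1..n}" for x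
    using that ijk by (auto simp: Transposition.transpose_def)
  have u: "set u \<subseteq> {1..n}" "length u = length w" using w(1) \<pi> by (auto simp: u_def)
  \<comment> \<open>The degree of [x_i, rn u] in x_i; the successor counts the leading
    letter.\<close>
  define c where "c = Suc (count (mset u) i)"
  define q where "q = Suc (length w)"
  let ?f = "weight_rename n q i c ?\<pi>"
  let ?v = "bracket (gen i) (gen k) :: 'k tensor"
  let ?r = "rn u :: 'k tensor"
  let ?B = "der_bracket (der_single n k ?r) (der_single n i ?v)"
  have v: "?v \<in> lie_part n 2" by (rule bracket_gen_mem_lie_part[OF ijk(1,3)])
  have rnu: "?r \<in> lie_part n (length w)" using rn_mem_lie_part[OF u(1)] u(2) by simp
  have Dv: "der_single n i ?v \<in> Der_deg n 2" by (rule der_single_mem_Der_deg[OF v])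
  have Du: "der_single n k ?r \<in> Der_deg n (length w)" by (rule der_single_mem_Der_deg[OF rnu])
  have Dv': "der_single n i ?v \<in> Der n" and Du': "der_single n k ?r \<in> Der n"
    using Dv Du Der_deg_subset_Der by blast+
  have "?B \<in> Der_deg n q"
    using Der_deg_der_bracket[OF Du Dv] w(2) by (simp add: q_def)
  moreover have "?B \<in> S" using S(1) mem by (simp add: u_def)
  moreover have "?f \<in> Schur q n" by (rule weight_rename_mem_Schur[OF \<pi>])
  moreover have "q \<ge> 2" using w(2) by (simp add: q_def)
  ultimately have "Phi n ?f ?B \<in> S" using S(2) unfolding Schur_invariant_def by blast
  moreover have "Phi n ?f ?B = der_single n i (rn (j # w))"
    unfolding Phi_def der_single_def[of n i "rn (j # w)"]
  proof (rule der_of_cong)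
    fix m assume m: "m \<in> {1..n}"
    have ne: "u \<noteq> []" "w \<noteq> []" using u(2) w(2) by auto
    consider "m = i" | "m = k" | "m \<noteq> i" "m \<noteq> k" by blast
    then show "?f (?B (gen m)) = (if m = i then rn (j # w) else 0)"
    proof cases
      case 1
      \<comment> \<open>As \<open>i \<noteq> k\<close>, the derivation D(k, r) kills x_i. Only one
        term of the commutator survives, and it acts on [x_i, x_k] through x_k alone.\<close>
      have "?B (gen i) = der_single n k ?r ?v"
        using ijk by (simp add: der_bracket_def der_single_gen[OF v] der_single_gen[OF rnu]
          Der_zero_arg[OF Dv'])
      also have "\<dots> = bracket (gen i) ?r"
        using ijk by (simp add: Der_bracket_arg[OF Du'] free_lie.gen der_single_gen[OF rnu])
      finally have B: "?B (gen i) = rn (i # u)" by (simp add: rn_Cons ne)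
      have "set (i # u) \<subseteq> {1..n}" using u(1) ijk(1) by simp
      from rn_mem_lie_part[OF this] have "(rn (i # u) :: 'k tensor) \<in> tensor_power n q"
        using lie_part_subset_tensor_power u(2) by (auto simp: q_def)
      moreover have "(rn (i # u) :: 'k tensor) \<in> homogeneous i c"
        using homogeneous_rn[of "i # u" i] by (simp add: c_def)
      ultimately have "?f (rn (i # u)) = (rn (map ?\<pi> (i # u)) :: 'k tensor)"
        by (simp only: weight_rename_homogeneous(1) lin_map_rn)
      also have "map ?\<pi> (i # u) = j # w" by (simp add: u_def o_def)
      finally show ?thesis using 1 B by simp
    next
      case 2
      \<comment> \<open>Now D(i, v) kills x_k, and what remains has the degree of r in x_i, one
        below \<open>c\<close>.\<close>
      have "?B (gen k) = 0 - der_single n i ?v ?r"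
        using ijk by (simp add: der_bracket_def der_single_gen[OF v] der_single_gen[OF rnu]
          Der_zero_arg[OF Du'])
      also have "\<dots> \<in> homogeneous i (count (mset u) i)"
        by (intro homogeneous_diff homogeneous_zero homogeneous_der_single_rn ijk u)
      finally have "?f (?B (gen k)) = 0"
        by (rule weight_rename_homogeneous(2)) (simp add: c_def)
      with 2 ijk(4) show ?thesis by simp
    next
      case 3
      then have "?B (gen m) = 0"
        using m by (simp add: der_bracket_def der_single_gen[OF v] der_single_gen[OF rnu]
          Der_zero_arg[OF Du'] Der_zero_arg[OF Dv'])
      \<comment> \<open>Zero is homogeneous of every degree; \<open>Suc c\<close> merely serves as
        one different from \<open>c\<close>.\<close>
      with 3 show ?thesis
        using weight_rename_homogeneous(2)[OF homogeneous_zero, of "Suc c" c] by simp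
    qed
  qed
  ultimately show ?thesis by simp
qed

text \<open>Induction on the length of \<open>w\<close>: length two comes from
  \<open>M_tilde\<close>, longer words from \<open>rn_step\<close>.\<close>

lemma der_single_rn_mem:
  fixes S :: "('k::{comm_ring, comm_monoid_mult} tensor \<Rightarrow> 'k tensor) set"
  assumes S: "lie_subalgebra_Der_star n S" "M_tilde n \<subseteq> S" "Schur_invariant n S"
    and "length w \<ge> 2" "set w \<subseteq> {1..n}" "i \<in> {1..n}"
  shows "der_single n i (rn w) \<in> S"
proof -
  have zero: "(\<lambda>_. 0) \<in> S" and smult: "\<And>c D. D \<in> S \<Longrightarrow> (\<lambda>a. smult c (D a)) \<in> S"
    and bracket: "\<And>D D'. D \<in> S \<Longrightarrow> D' \<in> S \<Longrightarrow> der_bracket D D' \<in> S"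
    using S(1) by (auto simp: lie_subalgebra_Der_star_def)
  have swap: "der_single n i (bracket (gen s) (gen t)) \<in> S"
    if "der_single n i (bracket (gen t) (gen s)) \<in> S" "s \<in> {1..n}" "t \<in> {1..n}" for i s t
  proof -
    have "bracket (gen s) (gen t) = smult (-1) (bracket (gen t) (gen s) :: 'k tensor)"
      using bracket_swap[of "gen s" "gen t"] by (simp add: smult_distrib)
    then show ?thesis
      using smult[OF that(1), of "-1"] that(2,3)
      by (simp add: der_single_smult[OF bracket_gen_mem_lie_part])
  qed
  have chi: "der_single n i (bracket (gen i) (gen j)) \<in> S"
    if "i \<in> {1..n}" "j \<in> {1..n}" "i \<noteq> j" for i j
    using S(2) that unfolding M_tilde_def chi_tilde_eq by blast
  have theta: "der_single n i (bracket (gen s) (gen t)) \<in> S"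
    if "i \<in> {1..n}" "s \<in> {1..n}" "t \<in> {1..n}" "s < t" "i \<notin> {s, t}" for i s t
    using S(2) that unfolding M_tilde_def theta_tilde_eq by blast
  \<comment> \<open>The brackets of two generators that \<open>M_tilde\<close> does not list are 0
    or negatives of listed ones.\<close>
  have two: "der_single n i (bracket (gen s) (gen t)) \<in> S"
    if "i \<in> {1..n}" "s \<in> {1..n}" "t \<in> {1..n}" for i s t
  proof -
    consider "s = t" | "s \<noteq> t" "i = s" | "s \<noteq> t" "i = t" | "s < t" "i \<notin> {s, t}" | "t < s" "i \<notin> {t, s}"
      by fastforce
    then show ?thesis
    proof cases
      case 1
      then show ?thesis by (simp add: der_single_zero zero)
    next
      case 2
      then show ?thesis using chi that by simp
    next
      case 3
      then show ?thesis using swap[OF chi] that by simp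
    next
      case 4
      then show ?thesis using theta that by simp
    next
      case 5
      then show ?thesis using swap[OF theta] that by simp
    qed
  qed
  show ?thesis
    using assms(4-6)
  \<comment> \<open>The step uses the hypothesis for another generator \<open>k\<close> and a word
    with transposed letters, so \<open>w\<close> and \<open>i\<close> both vary.\<close>
  proof (induction "length w" arbitrary: w i rule: less_induct)
    case less
    obtain j w' where w: "w = j # w'" using less.prems(1) by (cases w) auto
    show ?case
    proof (cases "length w' = 1")
      case True
      then obtain t where "w' = [t]" by (auto simp: length_Suc_conv)
      then show ?thesis using two less.prems w by simp
    next
      case False
      then have w': "length w' \<ge> 2" "set w' \<subseteq> {1..n}" and j: "j \<in> {1..n}"
        using less.prems by (auto simp: w)
      show ?thesis
      proof (cases "\<exists>k\<in>{1..n}. i \<noteq> k")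
        case True
        then obtain k where k: "k \<in> {1..n}" "i \<noteq> k" by blast
        let ?u = "map (Transposition.transpose i j) w'"
        have "set ?u \<subseteq> {1..n}"
          using w'(2) less.prems(3) j by (auto simp: Transposition.transpose_def)
        then have "der_single n k (rn ?u) \<in> S"
          using w' k(1) by (intro less.hyps) (simp_all add: w)
        then show ?thesis
          unfolding w using less.prems(3) j k w' by (intro rn_step[OF bracket S(3) _ _ k(1)] two) simp_all
      next
        case False
        \<comment> \<open>Without a second generator only one letter exists, and right-normed
          brackets of length at least two vanish.\<close>
        then have "set w \<subseteq> {i}" using less.prems(2) by (metis insertI1 subset_eq)
        then show ?thesis using less.prems(1) by (simp add: rn_constant der_single_zero zero)
      qed
    qed
  qed
qed

lemma Der_star_subset:
  fixes S :: "('k::{comm_ring, comm_monoid_mult} tensor \<Rightarrow> 'k tensor) set"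
  assumes S: "lie_subalgebra_Der_star n S" "M_tilde n \<subseteq> S" "Schur_invariant n S"
  shows "Der_star n \<subseteq> S"
proof -
  have zero: "(\<lambda>_. 0) \<in> S" and add: "\<And>D D'. D \<in> S \<Longrightarrow> D' \<in> S \<Longrightarrow> (\<lambda>a. D a + D' a) \<in> S"
    and smult: "\<And>c D. D \<in> S \<Longrightarrow> (\<lambda>a. smult c (D a)) \<in> S"
    using S(1) by (auto simp: lie_subalgebra_Der_star_def)
  have single: "der_single n i a \<in> S" if a: "a \<in> lie_part n p" and "p \<ge> 2" "i \<in> {1..n}" for i p a
  proof -
    have "a \<in> rn_span n p" using a by (simp add: lie_part_eq_rn_span)
    \<comment> \<open>Membership in \<open>lie_part\<close> is carried along because
      \<open>der_single_add\<close> needs it for both summands.\<close>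
    then have "a \<in> lie_part n p \<and> der_single n i a \<in> S"
    proof (induction rule: rn_span_induct)
      case (rn w c)
      then have mem: "rn w \<in> lie_part n p" using rn_mem_lie_part by blast
      have "der_single n i (rn w) \<in> S"
        using rn.hyps \<open>p \<ge> 2\<close> \<open>i \<in> {1..n}\<close> by (intro der_single_rn_mem[OF S]) simp_all
      then show ?case by (simp add: der_single_smult[OF mem] smult lie_part_smult[OF mem])
    qed (auto simp: der_single_zero zero lie_part_zero der_single_add add lie_part_add)
    then show ?thesis by blast
  qed
  have deg: "D \<in> S" if D: "D \<in> Der_deg n p" and "p \<ge> 2" for D p
  proof -
    have DS: "der_single n i (D (gen i)) \<in> S" if "i \<in> {1..n}" for i
      using D \<open>p \<ge> 2\<close> that by (intro single[of _ p]) (auto simp: Der_deg_def)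
    have Dg: "D (gen i) \<in> lie_part n p" if "i \<in> {1..n}" for i
      using D that by (simp add: Der_deg_def)
    \<comment> \<open>At x_k only the summand with index \<open>k\<close> contributes, and
      derivations are determined by their values on generators.\<close>
    have "D = (\<lambda>a. \<Sum>i\<in>{1..n}. der_single n i (D (gen i)) a)"
    proof (rule Der_eqI)
      show "D \<in> Der n" using D by (simp add: Der_deg_def)
      show "(\<lambda>a. \<Sum>i\<in>{1..n}. der_single n i (D (gen i)) a) \<in> Der n"
        using der_single_mem_Der_deg[OF Dg] Der_deg_subset_Der
        by (intro subspace_sum Der_zero Der_add) blast+
      fix k assume k: "k \<in> {1..n}"
      have "(\<Sum>i\<in>{1..n}. der_single n i (D (gen i)) (gen k)) = (\<Sum>i\<in>{1..n}. if k = i then D (gen i) else 0)"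
        by (intro sum.cong refl der_single_gen[OF Dg k])
      then show "D (gen k) = (\<Sum>i\<in>{1..n}. der_single n i (D (gen i)) (gen k))"
        using k by simp
    qed
    moreover have "(\<lambda>a. \<Sum>i\<in>{1..n}. der_single n i (D (gen i)) a) \<in> S"
      by (intro subspace_sum zero add DS)
    ultimately show ?thesis by simp
  qed
  show ?thesis
  proof
    fix E :: "'k tensor \<Rightarrow> 'k tensor" assume "E \<in> Der_star n"
    then obtain P D where P: "P \<subseteq> {2..}" "\<And>p. p \<in> P \<Longrightarrow> D p \<in> Der_deg n p" "E = (\<lambda>a. \<Sum>p\<in>P. D p a)"
      using Der_starE by metis
    show "E \<in> S"
      unfolding P(3)
    proof (intro subspace_sum zero add)
      fix p assume "p \<in> P"
      then show "D p \<in> S" using P(1) by (intro deg[OF P(2)]) auto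
    qed
  qed
qed

theorem theorem6p5:
  fixes n :: nat
  assumes "n \<ge> 1"
  shows "S_bar n (M_tilde n :: ('k::{comm_ring, comm_monoid_mult} tensor \<Rightarrow> 'k tensor) set)
       = Der_star n"
proof
  show "Der_star n \<subseteq> S_bar n (M_tilde n :: ('k tensor \<Rightarrow> 'k tensor) set)"
    unfolding S_bar_def by (rule Inter_greatest) (use Der_star_subset in blast)
  \<comment> \<open>\<open>Der_star n\<close> is itself one of the invariant subalgebras being
    intersected.\<close>
  show "S_bar n (M_tilde n :: ('k tensor \<Rightarrow> 'k tensor) set) \<subseteq> Der_star n"
    unfolding S_bar_def
    by (rule Inter_lower)
      (simp add: lie_subalgebra_Der_star_Der_star M_tilde_subset_Der_star Schur_invariant_Der_star)
qed

end
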